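(* Let $\ell$ be a positive integer. If $\mathcal M$ is the class of frame matroids with no $U_{2,\ell+2}$-minor, then $h_{\mathcal M}(n) = (\ell-1)\binom{n}{2} + n$ for all positive integers $n$.
   Context: Matroids are finite. A matroid $M$ is framed by a set $B$ if $B$ is a basis of $M$ and every element of $M$ is spanned by a subset of $B$ of size at most $2$. A frame matroid is a restriction of a matroid that is framed by some set $B$. $U_{2,k}$ is the rank-$2$ uniform matroid on $k$ elements; "no $N$-minor" means no minor isomorphic to $N$. For a nonempty minor-closed class $\mathcal M$ of matroids, $h_{\mathcal M}(n)$ is the maximum number of elements in a simple matroid in $\mathcal M$ whose rank is at most $n$. *)

theory Defs
  imports Main "HOL-Library.Infinite_Typeclass"
begin

record 'a set_system =
  ground :: "'a set"
  indeps :: "'a set set"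

locale matroid =
  fixes M :: "'a set_system"
  assumes finite_ground: "finite (ground M)"
    and indep_subset_ground: "X \<in> indeps M \<Longrightarrow> X \<subseteq> ground M"
    and indep_empty: "{} \<in> indeps M"
    and indep_mono: "X \<in> indeps M \<Longrightarrow> Y \<subseteq> X \<Longrightarrow> Y \<in> indeps M"
    and indep_augment: "X \<in> indeps M \<Longrightarrow> Y \<in> indeps M \<Longrightarrow> card X < card Y \<Longrightarrow>
      \<exists>y \<in> Y - X. insert y X \<in> indeps M"

definition rank_of :: "'a set_system \<Rightarrow> 'a set \<Rightarrow> nat" where
  "rank_of M X = Max (card ` {I \<in> indeps M. I \<subseteq> X})"

definition matroid_rank :: "'a set_system \<Rightarrow> nat" where
  "matroid_rank M = rank_of M (ground M)"

definition basis :: "'a set_system \<Rightarrow> 'a set \<Rightarrow> bool" where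
  "basis M B \<longleftrightarrow> B \<in> indeps M \<and> (\<forall>I \<in> indeps M. B \<subseteq> I \<longrightarrow> I = B)"

definition closure_of_set :: "'a set_system \<Rightarrow> 'a set \<Rightarrow> 'a set" where
  "closure_of_set M X = {e \<in> ground M. rank_of M (insert e X) = rank_of M X}"

definition loop :: "'a set_system \<Rightarrow> 'a \<Rightarrow> bool" where
  "loop M e \<longleftrightarrow> e \<in> ground M \<and> {e} \<notin> indeps M"

definition parallel_pair :: "'a set_system \<Rightarrow> 'a \<Rightarrow> 'a \<Rightarrow> bool" where
  "parallel_pair M e f \<longleftrightarrow> e \<in> ground M \<and> f \<in> ground M \<and> e \<noteq> f \<and>
     \<not> loop M e \<and> \<not> loop M f \<and> {e, f} \<notin> indeps M"

definition simple_matroid :: "'a set_system \<Rightarrow> bool" where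
  "simple_matroid M \<longleftrightarrow> matroid M \<and> (\<nexists>e. loop M e) \<and> (\<nexists>e f. parallel_pair M e f)"

definition restriction :: "'a set_system \<Rightarrow> 'a set \<Rightarrow> 'a set_system" where
  "restriction M X = \<lparr>ground = ground M \<inter> X, indeps = {I \<in> indeps M. I \<subseteq> X}\<rparr>"

definition deletion :: "'a set_system \<Rightarrow> 'a set \<Rightarrow> 'a set_system" where
  "deletion M D = restriction M (ground M - D)"

definition contraction :: "'a set_system \<Rightarrow> 'a set \<Rightarrow> 'a set_system" where
  "contraction M C = \<lparr>ground = ground M - C,
     indeps = {I. I \<subseteq> ground M - C \<and> rank_of M (I \<union> C) = card I + rank_of M C}\<rparr>"

definition is_minor :: "'a set_system \<Rightarrow> 'a set_system \<Rightarrow> bool" where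
  "is_minor N M \<longleftrightarrow> (\<exists>C D. C \<subseteq> ground M \<and> D \<subseteq> ground M \<and> C \<inter> D = {} \<and>
     N = deletion (contraction M C) D)"

definition isomorphic :: "'a set_system \<Rightarrow> 'b set_system \<Rightarrow> bool" where
  "isomorphic M N \<longleftrightarrow> (\<exists>f. bij_betw f (ground M) (ground N) \<and>
     (\<forall>X \<subseteq> ground M. X \<in> indeps M \<longleftrightarrow> f ` X \<in> indeps N))"

definition has_minor :: "'a set_system \<Rightarrow> 'b set_system \<Rightarrow> bool" where
  "has_minor M N \<longleftrightarrow> (\<exists>N'. is_minor N' M \<and> isomorphic N' N)"

definition uniform_matroid :: "nat \<Rightarrow> nat \<Rightarrow> nat set_system" where
  "uniform_matroid r k = \<lparr>ground = {..<k}, indeps = {X. X \<subseteq> {..<k} \<and> card X \<le> r}\<rparr>"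

definition framed_by :: "'a set_system \<Rightarrow> 'a set \<Rightarrow> bool" where
  "framed_by M B \<longleftrightarrow> matroid M \<and> basis M B \<and>
     (\<forall>e \<in> ground M. \<exists>S \<subseteq> B. card S \<le> 2 \<and> e \<in> closure_of_set M S)"

text \<open>The framed matroid witnessing that \<open>M\<close> is a frame matroid lives on the same type as \<open>M\<close>.
  Over an infinite type this is no loss, since there is always room for the additional elements.\<close>

definition frame_matroid :: "'a set_system \<Rightarrow> bool" where
  "frame_matroid M \<longleftrightarrow> (\<exists>M' B X. framed_by M' B \<and> X \<subseteq> ground M' \<and> M = restriction M' X)"

definition simple_sizes :: "'a set_system set \<Rightarrow> nat \<Rightarrow> nat set" where
  "simple_sizes \<M> n = {card (ground M) | M. M \<in> \<M> \<and> simple_matroid M \<and> matroid_rank M \<le> n}"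

text \<open>Since \<open>Max\<close> is unspecified on infinite and on empty sets, \<open>extremal_function \<M> n\<close> is meaningful
  only if \<open>simple_sizes \<M> n\<close> is finite and nonempty. A class of matroids, closed under isomorphism,
  is represented by its members on an infinite type; every finite matroid has an isomorphic copy
  there.\<close>

definition extremal_function :: "'a set_system set \<Rightarrow> nat \<Rightarrow> nat" where
  "extremal_function \<M> n = Max (simple_sizes \<M> n)"

end

theory Submission
  imports Defs Complex_Main "HOL-Library.Function_Algebras"
begin

text \<open>
  Upper bound. After contracting part of the frame we may assume that a frame \<open>B\<close> has size
  \<open>r(M)\<close>. Every element lies in the span of one or two elements of \<open>B\<close>, so \<open>M\<close> becomes a
  multigraph with loops on \<open>B\<close>. Call a pair of vertices heavy if at least \<open>l\<close> elements join it.
  Contracting one of two parallel edges turns the other into a loop, and a pair with a loop at both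
  ends carries at most \<open>l - 1\<close> edges; hence the graph of heavy pairs has no path with three edges.
  Its components are therefore single edges, stars and triangles, and in each of them the surplus
  of the heavy pairs over \<open>l - 1\<close>, together with the loops, is at most the number of vertices.

  Lower bound. The Dowling geometry of the group of \<open>(l - 1)\<close>-th roots of unity consists of the
  vectors \<open>e\<^sub>i\<close> and \<open>e\<^sub>i - g e\<^sub>j\<close>. Contraction maps each \<open>e\<^sub>i\<close> to zero or to a multiple \<open>g e\<^sub>j\<close>,
  so it stays within vectors of this shape, and a plane contains at most \<open>l + 1\<close> of them up to
  scaling. For \<open>l = 1\<close> the free matroids are extremal.
\<close>

section \<open>Matroids\<close>

text \<open>A minor may only contract elements of the given matroid, and the frame may lie outside
  it. Two parallel edges make up for this: they are independent by simplicity, so together they span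
  both of their ends and do the work of the missing frame elements. Hence a pair needs at least two
  edges to act on its neighbours. Heavy pairs have them when \<open>l \<ge> 2\<close>; at
  \<open>l = 1\<close> a single edge would be heavy, so that case goes through circuits instead. The
  constant \<open>l - 1\<close> is what remains of a line of \<open>l + 1\<close> points after a
  loop at each end is set aside. The lower bound needs a group of order \<open>l - 1\<close> inside
  the multiplicative group of a field; over the complex numbers the roots of unity provide it for
  every \<open>l \<ge> 2\<close>, with no arithmetic condition on \<open>l\<close>.\<close>

context matroid
begin

section \<open>Independent sets and rank\<close>

lemma indep_finite: "I \<in> indeps M \<Longrightarrow> finite I"
  using finite_ground indep_subset_ground finite_subset by blast

lemma finite_indeps: "finite (indeps M)"
  by (rule finite_subset[of _ "Pow (ground M)"]) (use indep_subset_ground finite_ground in auto)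

lemma rank_attained: "\<exists>I \<in> indeps M. I \<subseteq> X \<and> card I = rank_of M X"
proof -
  have "Max (card ` {I \<in> indeps M. I \<subseteq> X}) \<in> card ` {I \<in> indeps M. I \<subseteq> X}"
    by (rule Max_in) (use finite_indeps indep_empty in auto)
  then obtain I where "I \<in> indeps M" "I \<subseteq> X" "Max (card ` {I \<in> indeps M. I \<subseteq> X}) = card I"
    by blast
  then show ?thesis
    unfolding rank_of_def by metis
qed

lemma card_le_rank: "I \<in> indeps M \<Longrightarrow> I \<subseteq> X \<Longrightarrow> card I \<le> rank_of M X"
  unfolding rank_of_def by (rule Max_ge) (use finite_indeps in auto)

lemma rank_mono: "X \<subseteq> Y \<Longrightarrow> rank_of M X \<le> rank_of M Y"
  using rank_attained[of X] card_le_rank[of _ Y] by (metis subset_trans)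

lemma rank_le_card: "finite X \<Longrightarrow> rank_of M X \<le> card X"
  using rank_attained[of X] card_mono[of X] by metis

lemma rank_indep: "I \<in> indeps M \<Longrightarrow> rank_of M I = card I"
  by (intro antisym card_le_rank rank_le_card indep_finite) simp_all

lemma rank_empty [simp]: "rank_of M {} = 0"
  using rank_le_card[of "{}"] by simp

lemma indep_iff_rank: "finite I \<Longrightarrow> I \<in> indeps M \<longleftrightarrow> rank_of M I = card I"
  using rank_attained[of I] card_subset_eq[of I] rank_indep[of I] by metis

lemma indep_extend:
  assumes "I \<in> indeps M" "I \<subseteq> X"
  obtains J where "J \<in> indeps M" "I \<subseteq> J" "J \<subseteq> X" "card J = rank_of M X"
proof -
  have "\<exists>J \<in> indeps M. I \<subseteq> J \<and> J \<subseteq> X \<and> card J = rank_of M X"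
    using assms
  proof (induction "rank_of M X - card I" arbitrary: I rule: less_induct)
    case less
    obtain K where K: "K \<in> indeps M" "K \<subseteq> X" "card K = rank_of M X"
      using rank_attained by blast
    show ?case
    proof (cases "card I = rank_of M X")
      case False
      then have lt: "card I < card K"
        using card_le_rank[OF less.prems] K by linarith
      then obtain y where y: "y \<in> K - I" "insert y I \<in> indeps M"
        using indep_augment[OF less.prems(1) K(1)] by blast
      have "card (insert y I) = Suc (card I)"
        using y indep_finite less.prems by simp
      then have "rank_of M X - card (insert y I) < rank_of M X - card I"
        using K lt by linarith
      moreover have "insert y I \<subseteq> X"
        using y K less.prems by blast
      ultimately show ?thesis
        using less.hyps[of "insert y I"] y(2) by blast
    qed (use less.prems in blast)
  qed
  then show ?thesis using that by blast
qed

lemma indep_extend_by: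
  assumes "I \<in> indeps M" "B \<in> indeps M" "card I \<le> card B"
  obtains D where "D \<subseteq> B - I" "I \<union> D \<in> indeps M" "card (I \<union> D) = card B"
proof -
  have "\<exists>D \<subseteq> B - I. I \<union> D \<in> indeps M \<and> card (I \<union> D) = card B"
    using assms(1,3)
  proof (induction "card B - card I" arbitrary: I rule: less_induct)
    case less
    show ?case
    proof (cases "card I = card B")
      case False
      then obtain y where y: "y \<in> B - I" "insert y I \<in> indeps M"
        using indep_augment[OF less.prems(1) assms(2)] less.prems(2) by auto
      have "card (insert y I) = Suc (card I)"
        using y indep_finite less.prems by simp
      then have "card B - card (insert y I) < card B - card I" "card (insert y I) \<le> card B"
        using less.prems False by linarith+
      then obtain D where D: "D \<subseteq> B - insert y I" "insert y I \<union> D \<in> indeps M"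
        "card (insert y I \<union> D) = card B"
        using less.hyps[of "insert y I"] y(2) by blast
      have eq: "I \<union> insert y D = insert y I \<union> D" by simp
      have "insert y D \<subseteq> B - I" using D(1) y(1) by blast
      then show ?thesis
        using D(2,3) unfolding eq[symmetric] by blast
    next
      case True
      then have "{} \<subseteq> B - I" "I \<union> {} \<in> indeps M" "card (I \<union> {}) = card B"
        using less.prems by simp_all
      then show ?thesis by blast
    qed
  qed
  then show ?thesis using that by blast
qed

lemma rank_submodular:
  "rank_of M (X \<union> Y) + rank_of M (X \<inter> Y) \<le> rank_of M X + rank_of M Y"
proof -
  obtain I where I: "I \<in> indeps M" "I \<subseteq> X \<inter> Y" "card I = rank_of M (X \<inter> Y)"
    using rank_attained by blast
  obtain K where K: "K \<in> indeps M" "I \<subseteq> K" "K \<subseteq> X \<union> Y" "card K = rank_of M (X \<union> Y)"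
    using indep_extend[of I "X \<union> Y"] I by blast
  have fin: "finite K" using K indep_finite by blast
  have "card (K \<inter> X) \<le> rank_of M X" "card (K \<inter> Y) \<le> rank_of M Y"
    using K indep_mono by (auto intro!: card_le_rank)
  moreover have "card I \<le> card ((K \<inter> X) \<inter> (K \<inter> Y))"
    using I K fin by (intro card_mono) auto
  moreover have "card (K \<inter> X) + card (K \<inter> Y) = card K + card ((K \<inter> X) \<inter> (K \<inter> Y))"
    using card_Un_Int[of "K \<inter> X" "K \<inter> Y"] fin K by (simp add: Int_Un_distrib[symmetric] Int_absorb2)
  ultimately show ?thesis using I K by linarith
qed

lemma rank_insert_le: "rank_of M (insert e X) \<le> Suc (rank_of M X)"
proof -
  have "rank_of M {e} \<le> 1"
    using rank_le_card[of "{e}"] by simp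
  then show ?thesis
    using rank_submodular[of "{e}" X] by simp
qed

section \<open>Closure and exchange\<close>

abbreviation cl :: "'a set \<Rightarrow> 'a set" where
  "cl \<equiv> closure_of_set M"

lemma cl_subset_ground: "cl A \<subseteq> ground M"
  by (auto simp: closure_of_set_def)

lemma cl_superset: "A \<subseteq> ground M \<Longrightarrow> A \<subseteq> cl A"
  by (auto simp: closure_of_set_def insert_absorb)

lemma rank_insert_notin_cl:
  "e \<in> ground M \<Longrightarrow> e \<notin> cl A \<Longrightarrow> rank_of M (insert e A) = Suc (rank_of M A)"
  using rank_insert_le[of e A] rank_mono[OF subset_insertI[of A e]]
  by (auto simp: closure_of_set_def)

lemma cl_mono: "A \<subseteq> A' \<Longrightarrow> cl A \<subseteq> cl A'"
proof
  fix e assume *: "A \<subseteq> A'" "e \<in> cl A"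
  show "e \<in> cl A'"
  proof (cases "e \<in> A'")
    case False
    have "insert e A \<union> A' = insert e A'" "insert e A \<inter> A' = A"
      using * False by auto
    then have "rank_of M (insert e A') \<le> rank_of M A'"
      using * rank_submodular[of "insert e A" A'] by (simp add: closure_of_set_def)
    then show ?thesis
      using * rank_mono[OF subset_insertI[of A' e]] by (auto simp: closure_of_set_def)
  qed (use * cl_subset_ground in \<open>auto simp: closure_of_set_def insert_absorb\<close>)
qed

lemma rank_Un_cl:
  assumes "A \<subseteq> cl T"
  shows "rank_of M (A \<union> T) = rank_of M T"
proof -
  have "finite A"
    using assms cl_subset_ground finite_ground finite_subset by (meson subset_trans)
  then show ?thesis
    using assms
  proof (induction A rule: finite_induct)
    case (insert a A)
    then have "a \<in> cl (A \<union> T)"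
      using cl_mono[of T "A \<union> T"] by blast
    then show ?case
      using insert by (simp add: closure_of_set_def)
  qed simp
qed

lemma rank_le_of_subset_cl: "A \<subseteq> cl T \<Longrightarrow> rank_of M A \<le> rank_of M T"
  by (metis rank_Un_cl rank_mono sup_ge1)

lemma cl_subset_cl:
  assumes "A \<subseteq> cl T" shows "cl A \<subseteq> cl T"
proof
  fix e assume e: "e \<in> cl A"
  then have "e \<in> cl (A \<union> T)"
    using cl_mono[of A "A \<union> T"] by blast
  then have "rank_of M (insert e (A \<union> T)) = rank_of M T"
    using rank_Un_cl[OF assms] by (simp add: closure_of_set_def)
  then have "rank_of M (insert e T) \<le> rank_of M T"
    using rank_mono[of "insert e T" "insert e (A \<union> T)"] by auto
  then show "e \<in> cl T"
    using e rank_mono[OF subset_insertI[of T e]] by (auto simp: closure_of_set_def)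
qed

lemma cl_exchange:
  assumes "e \<in> cl (insert f A)" "e \<notin> cl A" "f \<in> ground M"
  shows "f \<in> cl (insert e A)"
proof -
  have e: "e \<in> ground M" using assms cl_subset_ground by blast
  have "rank_of M (insert e (insert f A)) = rank_of M (insert f A)"
    using assms by (simp add: closure_of_set_def)
  moreover have "rank_of M (insert e A) = Suc (rank_of M A)"
    using rank_insert_notin_cl assms e by blast
  moreover have "rank_of M (insert e A) \<le> rank_of M (insert e (insert f A))"
    by (rule rank_mono) auto
  ultimately show ?thesis
    using rank_insert_le[of f A] assms(3) by (simp add: closure_of_set_def insert_commute)
qed

text \<open>Adding a point of \<open>T\<close> to \<open>A\<close> stays inside
  \<open>A \<union> T\<close>, whose rank is that of \<open>T\<close> and hence at most that of
  \<open>A\<close>. This turns an equality of ranks into spanning in the reverse direction.\<close>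

lemma in_cl_of_rank_eq:
  assumes "A \<subseteq> cl T" "rank_of M T \<le> rank_of M A" "T \<subseteq> ground M"
  shows "T \<subseteq> cl A"
proof
  fix t assume t: "t \<in> T"
  have "rank_of M (insert t A) \<le> rank_of M (A \<union> T)"
    using t by (intro rank_mono) auto
  also have "\<dots> = rank_of M T"
    by (rule rank_Un_cl[OF assms(1)])
  finally have "rank_of M (insert t A) = rank_of M A"
    using assms(2) rank_mono[OF subset_insertI[of A t]] by auto
  then show "t \<in> cl A"
    using t assms(3) by (auto simp: closure_of_set_def)
qed

text \<open>On subsets of an independent set the rank is cardinality, hence modular. Submodularity
  for \<open>insert e S\<close> and \<open>insert e T\<close> therefore leaves no room for
  \<open>e\<close> to raise the rank of \<open>S \<inter> T\<close>. This is what gives each element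
  a least spanning subset of the frame.\<close>

lemma cl_Int_indep:
  assumes "S \<union> T \<in> indeps M" "e \<in> cl S" "e \<in> cl T"
  shows "e \<in> cl (S \<inter> T)"
proof (cases "e \<in> S \<inter> T")
  case True
  then show ?thesis
    using assms(2) cl_subset_ground by (auto simp: closure_of_set_def insert_absorb)
next
  case False
  have fin: "finite S" "finite T"
    using indep_finite[OF assms(1)] by auto
  have ind: "S \<in> indeps M" "T \<in> indeps M" "S \<inter> T \<in> indeps M"
    by (rule indep_mono[OF assms(1)], blast)+
  have "rank_of M (insert e S \<union> insert e T) + rank_of M (insert e S \<inter> insert e T)
      \<le> rank_of M (insert e S) + rank_of M (insert e T)"
    by (rule rank_submodular)
  also have "\<dots> = card S + card T"
    using assms(2,3) ind by (simp add: closure_of_set_def rank_indep)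
  also have "\<dots> = rank_of M (S \<union> T) + rank_of M (S \<inter> T)"
    using card_Un_Int[OF fin] assms(1) ind by (simp add: rank_indep)
  also have "rank_of M (S \<union> T) \<le> rank_of M (insert e S \<union> insert e T)"
    by (rule rank_mono) auto
  finally have "rank_of M (insert e S \<inter> insert e T) \<le> rank_of M (S \<inter> T)"
    by simp
  moreover have "insert e S \<inter> insert e T = insert e (S \<inter> T)" by blast
  ultimately have "rank_of M (insert e (S \<inter> T)) \<le> rank_of M (S \<inter> T)" by simp
  then show ?thesis
    using assms(2) rank_mono[OF subset_insertI[of "S \<inter> T" e]]
    by (auto simp: closure_of_set_def)
qed

lemma basis_card_eq_rank:
  assumes "basis M B" shows "card B = matroid_rank M"
proof -
  have "B \<in> indeps M" using assms by (simp add: basis_def)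
  then obtain J where J: "J \<in> indeps M" "B \<subseteq> J" "card J = rank_of M (ground M)"
    using indep_extend[OF _ indep_subset_ground] by blast
  then have "J = B" using assms unfolding basis_def by blast
  then show ?thesis
    using J by (simp add: matroid_rank_def)
qed

lemma basis_if_card: "B \<in> indeps M \<Longrightarrow> card B = matroid_rank M \<Longrightarrow> basis M B"
  unfolding basis_def matroid_rank_def
  by (metis card_le_rank card_seteq indep_finite indep_subset_ground)

section \<open>Restriction and contraction\<close>

lemma matroid_restriction: "matroid (restriction M X)"
proof
  fix Y Z assume "Y \<in> indeps (restriction M X)" "Z \<in> indeps (restriction M X)" "card Y < card Z"
  then show "\<exists>y\<in>Z - Y. insert y Y \<in> indeps (restriction M X)"
    using indep_augment[of Y Z] by (fastforce simp: restriction_def)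
next
  fix Y Z assume "Y \<in> indeps (restriction M X)" "Z \<subseteq> Y"
  then show "Z \<in> indeps (restriction M X)"
    using indep_mono[of Y Z] by (auto simp: restriction_def)
qed (use indep_subset_ground in \<open>auto simp: restriction_def finite_ground indep_empty\<close>)

lemma rank_restriction: "A \<subseteq> X \<Longrightarrow> rank_of (restriction M X) A = rank_of M A"
  unfolding rank_of_def restriction_def
  by (rule arg_cong[where f = "\<lambda>S. Max (card ` S)"]) auto

lemma indep_contraction_iff:
  "I \<in> indeps (contraction M C) \<longleftrightarrow>
    I \<subseteq> ground M - C \<and> rank_of M (I \<union> C) = card I + rank_of M C"
  by (simp add: contraction_def)

lemma rank_Un_le: "finite X \<Longrightarrow> rank_of M (X \<union> C) \<le> card X + rank_of M C"
  using rank_submodular[of X C] rank_le_card[of X] by linarith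

text \<open>Independence is a rank equation here. If \<open>X\<close> attains the largest possible
  rank over \<open>C\<close>, so does each subset, by subadditivity. For augmentation, the larger
  set cannot lie in the closure of \<open>X \<union> C\<close>, and any of its points outside raises
  the rank by one.\<close>

lemma matroid_contraction: "matroid (contraction M C)"
proof
  fix X Y assume X: "X \<in> indeps (contraction M C)" and "Y \<subseteq> X"
  then have XE: "X \<subseteq> ground M - C" "rank_of M (X \<union> C) = card X + rank_of M C"
    by (auto simp: indep_contraction_iff)
  then have fin: "finite X" "finite Y"
    using finite_ground \<open>Y \<subseteq> X\<close> by (auto intro: finite_subset)
  have "X \<union> C = (X - Y) \<union> (Y \<union> C)" using \<open>Y \<subseteq> X\<close> by auto
  then have "card X + rank_of M C \<le> card (X - Y) + rank_of M (Y \<union> C)"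
    using XE rank_Un_le[of "X - Y" "Y \<union> C"] fin by simp
  moreover have "card X = card (X - Y) + card Y"
    using fin \<open>Y \<subseteq> X\<close> by (simp add: card_Diff_subset card_mono)
  ultimately have "rank_of M (Y \<union> C) = card Y + rank_of M C"
    using rank_Un_le[of Y C] fin by simp
  then show "Y \<in> indeps (contraction M C)"
    using XE \<open>Y \<subseteq> X\<close> by (auto simp: indep_contraction_iff)
next
  fix X Y
  assume X: "X \<in> indeps (contraction M C)" and Y: "Y \<in> indeps (contraction M C)"
    and lt: "card X < card Y"
  have "\<not> Y \<subseteq> cl (X \<union> C)"
  proof
    assume "Y \<subseteq> cl (X \<union> C)"
    from rank_Un_cl[OF this] have "rank_of M (Y \<union> C) \<le> rank_of M (X \<union> C)"
      using rank_mono[of "Y \<union> C" "Y \<union> (X \<union> C)"] by auto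
    then show False
      using X Y lt by (simp add: indep_contraction_iff)
  qed
  then obtain y where y: "y \<in> Y" "y \<notin> cl (X \<union> C)" by blast
  have sub: "X \<subseteq> ground M - C" "Y \<subseteq> ground M - C"
    using X Y by (auto simp: indep_contraction_iff)
  then have "finite X" using finite_ground finite_subset by blast
  have "y \<notin> X"
    using y sub by (auto simp: closure_of_set_def insert_absorb)
  moreover have "rank_of M (insert y (X \<union> C)) = Suc (rank_of M (X \<union> C))"
    using y sub by (intro rank_insert_notin_cl) auto
  ultimately have "insert y X \<in> indeps (contraction M C)"
    using X y sub \<open>finite X\<close> by (auto simp: indep_contraction_iff)
  then show "\<exists>y\<in>Y - X. insert y X \<in> indeps (contraction M C)"
    using y \<open>y \<notin> X\<close> by blast
qed (auto simp: contraction_def finite_ground)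

text \<open>The additive form avoids truncated subtraction. A largest independent
  \<open>I \<subseteq> A\<close> of the contraction spans \<open>A\<close> together with
  \<open>C\<close>, since a missed element could be added to \<open>I\<close>.\<close>

lemma rank_contraction:
  assumes "A \<subseteq> ground M - C"
  shows "rank_of (contraction M C) A + rank_of M C = rank_of M (A \<union> C)"
proof -
  interpret N: matroid "contraction M C" by (rule matroid_contraction)
  obtain I where I: "I \<in> indeps (contraction M C)" "I \<subseteq> A" "card I = rank_of (contraction M C) A"
    using N.rank_attained by blast
  have le: "rank_of (contraction M C) A + rank_of M C \<le> rank_of M (A \<union> C)"
    using I rank_mono[of "I \<union> C" "A \<union> C"] by (auto simp: indep_contraction_iff)
  have "A \<subseteq> cl (I \<union> C)"
  proof
    fix a assume a: "a \<in> A"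
    show "a \<in> cl (I \<union> C)"
    proof (rule ccontr)
      assume n: "a \<notin> cl (I \<union> C)"
      then have r: "rank_of M (insert a (I \<union> C)) = Suc (rank_of M (I \<union> C))"
        using a assms by (intro rank_insert_notin_cl) auto
      have "a \<notin> I" using r by (auto simp: insert_absorb)
      have "insert a I \<in> indeps (contraction M C)"
        using r I a assms N.indep_finite[OF I(1)] \<open>a \<notin> I\<close> by (auto simp: indep_contraction_iff)
      from N.card_le_rank[OF this, of A] show False
        using a I N.indep_finite[OF I(1)] \<open>a \<notin> I\<close> by simp
    qed
  qed
  from rank_Un_cl[OF this] have "rank_of M (A \<union> C) \<le> rank_of M (I \<union> C)"
    using rank_mono[of "A \<union> C" "A \<union> (I \<union> C)"] by auto
  then show ?thesis
    using le I by (auto simp: indep_contraction_iff)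
qed

text \<open>Contract \<open>C\<close> and delete all else outside \<open>Z\<close>: pairs become
  independent and the rank is at most 2, so independence means size at most 2.
  \<open>2 \<le> card Z\<close> lets smaller sets be completed to a pair. Stating everything by
  ranks suits restrictions, which preserve ranks.\<close>

lemma has_line_minorI:
  assumes "C \<subseteq> ground M" "Z \<subseteq> ground M" "C \<inter> Z = {}" "2 \<le> card Z"
    and le: "rank_of M (Z \<union> C) \<le> rank_of M C + 2"
    and ge: "\<And>x y. x \<in> Z \<Longrightarrow> y \<in> Z \<Longrightarrow> x \<noteq> y \<Longrightarrow> rank_of M C + 2 \<le> rank_of M ({x, y} \<union> C)"
  shows "has_minor M (uniform_matroid 2 (card Z))"
proof -
  define N where "N = deletion (contraction M C) (ground M - C - Z)"
  interpret MC: matroid "contraction M C" by (rule matroid_contraction)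
  have finZ: "finite Z" using assms finite_ground finite_subset by blast
  have ground: "ground N = Z"
    using assms by (auto simp: N_def deletion_def restriction_def contraction_def)
  have indepN: "X \<in> indeps N \<longleftrightarrow> X \<in> indeps (contraction M C)" if "X \<subseteq> Z" for X
    using that assms by (auto simp: N_def deletion_def restriction_def contraction_def)
  have pair: "{x, y} \<in> indeps (contraction M C)" if "x \<in> Z" "y \<in> Z" "x \<noteq> y" for x y
    using ge[OF that] rank_Un_le[of "{x, y}" C] that assms(2,3)
    by (auto simp: indep_contraction_iff)
  have iff: "X \<in> indeps N \<longleftrightarrow> card X \<le> 2" if X: "X \<subseteq> Z" for X
  proof
    assume "X \<in> indeps N"
    then have "card X + rank_of M C = rank_of M (X \<union> C)"
      using indepN[OF X] by (simp add: indep_contraction_iff)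
    also have "\<dots> \<le> rank_of M (Z \<union> C)"
      using X by (intro rank_mono) auto
    finally show "card X \<le> 2" using le by linarith
  next
    assume "card X \<le> 2"
    then obtain Y where Y: "X \<subseteq> Y" "Y \<subseteq> Z" "card Y = 2"
      using exists_subset_between[of X 2 Z] assms X finZ by auto
    then obtain x y where "Y = {x, y}" "x \<noteq> y" by (meson card_2_iff)
    then have "Y \<in> indeps (contraction M C)" using pair Y by auto
    then have "X \<in> indeps (contraction M C)"
      using Y MC.indep_mono by blast
    then show "X \<in> indeps N" using indepN[OF X] by blast
  qed
  obtain f where f: "bij_betw f Z {..<card Z}"
    using ex_bij_betw_finite_nat[OF finZ] by (auto simp: atLeast0LessThan)
  have "isomorphic N (uniform_matroid 2 (card Z))"
    unfolding isomorphic_def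
  proof (intro exI[of _ f] conjI allI impI)
    show "bij_betw f (ground N) (ground (uniform_matroid 2 (card Z)))"
      using f ground by (simp add: uniform_matroid_def)
  next
    fix X assume X: "X \<subseteq> ground N"
    have "inj_on f X" using X f ground by (metis bij_betw_def inj_on_subset)
    then have "card (f ` X) = card X" by (rule card_image)
    moreover have "f ` X \<subseteq> {..<card Z}"
      using X f ground by (auto simp: bij_betw_def)
    ultimately show "X \<in> indeps N \<longleftrightarrow> f ` X \<in> indeps (uniform_matroid 2 (card Z))"
      using iff X ground by (simp add: uniform_matroid_def)
  qed
  moreover have "is_minor N M"
    unfolding is_minor_def N_def using assms
    by (intro exI[of _ C] exI[of _ "ground M - C - Z"]) auto
  ultimately show ?thesis
    unfolding has_minor_def by blast
qed

text \<open>The minor is unpacked into closures because these become linear spans in a vector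
  matroid.\<close>

lemma has_line_minorD:
  assumes "has_minor M (uniform_matroid 2 k)"
  obtains C Z where "C \<subseteq> ground M" "Z \<subseteq> ground M" "C \<inter> Z = {}" "card Z = k"
    "\<And>x y. x \<in> Z \<Longrightarrow> y \<in> Z \<Longrightarrow> x \<noteq> y \<Longrightarrow> x \<notin> cl (insert y C)"
    "\<And>x y z. x \<in> Z \<Longrightarrow> y \<in> Z \<Longrightarrow> z \<in> Z \<Longrightarrow> x \<noteq> y \<Longrightarrow> z \<in> cl (insert x (insert y C))"
proof -
  obtain N f C D where CD: "C \<subseteq> ground M" "D \<subseteq> ground M" "C \<inter> D = {}"
    and N: "N = deletion (contraction M C) D"
    and f: "bij_betw f (ground N) {..<k}"
    and iso: "\<And>X. X \<subseteq> ground N \<Longrightarrow> X \<in> indeps N \<longleftrightarrow> f ` X \<in> indeps (uniform_matroid 2 k)"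
    using assms unfolding has_minor_def is_minor_def isomorphic_def
    by (auto simp: uniform_matroid_def)
  have gr: "ground N = ground M - C - D"
    by (auto simp: N deletion_def restriction_def contraction_def)
  have iff: "rank_of M (X \<union> C) = card X + rank_of M C \<longleftrightarrow> card X \<le> 2" if X: "X \<subseteq> ground N" for X
  proof -
    have "inj_on f X" using X f by (metis bij_betw_def inj_on_subset)
    then have "card (f ` X) = card X" by (rule card_image)
    moreover have "f ` X \<subseteq> {..<k}"
      using X f by (auto simp: bij_betw_def)
    moreover have "X \<in> indeps N \<longleftrightarrow> rank_of M (X \<union> C) = card X + rank_of M C"
      using X gr by (auto simp: N deletion_def restriction_def contraction_def)
    ultimately show ?thesis
      using iso[OF X] by (simp add: uniform_matroid_def)
  qed
  show ?thesis
  proof (rule that[of C "ground N"])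
    show "card (ground N) = k"
      using bij_betw_same_card[OF f] by simp
    show *: "x \<notin> cl (insert y C)" if "x \<in> ground N" "y \<in> ground N" "x \<noteq> y" for x y
      using iff[of "{x, y}"] iff[of "{y}"] that by (auto simp: closure_of_set_def)
    show "z \<in> cl (insert x (insert y C))"
      if "x \<in> ground N" "y \<in> ground N" "z \<in> ground N" "x \<noteq> y" for x y z
    proof (cases "z = x \<or> z = y")
      case True
      then show ?thesis
        using that gr by (auto simp: closure_of_set_def insert_absorb insert_commute)
    next
      case False
      show ?thesis
      proof (rule ccontr)
        assume "z \<notin> cl (insert x (insert y C))"
        then have "rank_of M (insert z (insert x (insert y C)))
            = Suc (rank_of M (insert x (insert y C)))"
          using that gr by (intro rank_insert_notin_cl) auto
        then show False
          using iff[of "{x, y}"] iff[of "{z, x, y}"] that False by simp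
      qed
    qed
  qed (use CD gr in auto)
qed

end

section \<open>A weighting of graphs without paths of length three\<close>

lemma sum_prod_split:
  fixes f :: "'v \<Rightarrow> 'v \<Rightarrow> nat"
  assumes "finite V" "R \<subseteq> V" and sym: "\<And>u v. f u v = f v u"
  shows "(\<Sum>u\<in>V. \<Sum>v\<in>V. f u v) = (\<Sum>u\<in>V - R. \<Sum>v\<in>V - R. f u v)
    + (\<Sum>u\<in>R. \<Sum>v\<in>R. f u v) + 2 * (\<Sum>u\<in>R. \<Sum>v\<in>V - R. f u v)"
proof -
  have split: "sum g V = sum g (V - R) + sum g R" for g :: "'v \<Rightarrow> nat"
    by (rule sum.subset_diff[OF assms(2,1)])
  have "(\<Sum>u\<in>V - R. \<Sum>v\<in>R. f u v) = (\<Sum>u\<in>R. \<Sum>v\<in>V - R. f u v)"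
    by (subst sum.swap) (simp add: sym)
  then show ?thesis
    by (simp add: split sum.distrib)
qed

text \<open>\<open>j\<close> counts loops and \<open>ex\<close> is the surplus of a pair; the factor
  2 comes from summing over ordered pairs. No components are classified: sets \<open>R\<close> of
  weight at most \<open>card R\<close>, including their edges to the rest, are peeled off one by
  one. \<open>U\<close> stays fixed, so every smaller \<open>V\<close> inherits the
  hypotheses.\<close>

lemma heavy_graph_weight:
  fixes j :: "'v \<Rightarrow> nat" and ex :: "'v \<Rightarrow> 'v \<Rightarrow> nat"
  assumes fin: "finite U"
    and sym: "\<And>u v. ex u v = ex v u"
    and irrefl: "\<And>u. ex u u = 0"
    and joint_le: "\<And>v. v \<in> U \<Longrightarrow> j v \<le> 1"
    and edge: "\<And>u v. u \<in> U \<Longrightarrow> v \<in> U \<Longrightarrow> ex u v > 0 \<Longrightarrow> ex u v + j u + j v \<le> 2"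
    and path2: "\<And>u v w. u \<in> U \<Longrightarrow> v \<in> U \<Longrightarrow> w \<in> U \<Longrightarrow> distinct [u, v, w] \<Longrightarrow>
      ex u v > 0 \<Longrightarrow> ex v w > 0 \<Longrightarrow> ex v w \<le> 1"
    and path3: "\<And>a u v b. a \<in> U \<Longrightarrow> u \<in> U \<Longrightarrow> v \<in> U \<Longrightarrow> b \<in> U \<Longrightarrow> distinct [a, u, v, b] \<Longrightarrow>
      ex a u > 0 \<Longrightarrow> ex u v > 0 \<Longrightarrow> ex v b > 0 \<Longrightarrow> False"
    and leaves: "\<And>u v w. u \<in> U \<Longrightarrow> v \<in> U \<Longrightarrow> w \<in> U \<Longrightarrow> distinct [u, v, w] \<Longrightarrow>
      ex u v > 0 \<Longrightarrow> ex u w > 0 \<Longrightarrow> j v > 0 \<Longrightarrow> j w > 0 \<Longrightarrow> False"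
    and triangle: "\<And>u v w. u \<in> U \<Longrightarrow> v \<in> U \<Longrightarrow> w \<in> U \<Longrightarrow> distinct [u, v, w] \<Longrightarrow>
      ex u v > 0 \<Longrightarrow> ex u w > 0 \<Longrightarrow> ex v w > 0 \<Longrightarrow> j u = 0"
    and "V \<subseteq> U"
  shows "2 * (\<Sum>v\<in>V. j v) + (\<Sum>u\<in>V. \<Sum>v\<in>V. ex u v) \<le> 2 * card V"
proof -
  have "finite V" using fin \<open>V \<subseteq> U\<close> by (rule finite_subset[rotated])
  then show ?thesis
    using \<open>V \<subseteq> U\<close>
  proof (induction V rule: finite_psubset_induct)
    case (psubset V)
    note inU = subsetD[OF psubset.prems]
    \<comment> \<open>Deleting \<open>R\<close> loses its loops, its inner pairs and the pairs
      leaving it, the last in both orders.\<close>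
    have remove: ?case
      if R: "R \<subseteq> V" "R \<noteq> {}"
        and le: "2 * sum j R + (\<Sum>u\<in>R. \<Sum>v\<in>R. ex u v) + 2 * (\<Sum>u\<in>R. \<Sum>v\<in>V - R. ex u v)
          \<le> 2 * card R" for R
    proof -
      have "2 * sum j (V - R) + (\<Sum>u\<in>V - R. \<Sum>v\<in>V - R. ex u v) \<le> 2 * card (V - R)"
        using psubset.IH[of "V - R"] R psubset.prems by blast
      moreover have "sum j V = sum j (V - R) + sum j R"
        by (rule sum.subset_diff[OF R(1) psubset.hyps])
      moreover have "card V = card (V - R) + card R"
        using R psubset.hyps by (simp add: card_Diff_subset card_mono finite_subset)
      ultimately show ?thesis
        using le sum_prod_split[OF psubset.hyps R(1), of ex, OF sym] by simp
    qed
    show ?case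
    proof (cases "\<exists>w\<in>V. j w + (\<Sum>v\<in>V. ex w v) \<le> 1")
      case True
      then obtain w where w: "w \<in> V" "j w + (\<Sum>v\<in>V. ex w v) \<le> 1" by blast
      have "(\<Sum>v\<in>V - {w}. ex w v) \<le> (\<Sum>v\<in>V. ex w v)"
        using psubset.hyps by (intro sum_mono2) auto
      then show ?thesis
        using w irrefl by (intro remove[of "{w}"]) auto
    next
      case False
      \<comment> \<open>No single vertex can be peeled off any more. As a vertex has at most one
        loop, each one now has a heavy neighbour.\<close>
      then have big: "j w + (\<Sum>v\<in>V. ex w v) \<ge> 2" if "w \<in> V" for w
        using that by force
      show ?thesis
      proof (cases "V = {}")
        case False
        then obtain a where a: "a \<in> V" by blast
        have "(\<Sum>v\<in>V. ex a v) \<noteq> 0"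
          using big[OF a] joint_le[OF inU[OF a]] by linarith
        then obtain b where b: "b \<in> V" "ex a b > 0"
          using psubset.hyps by auto
        have ab: "a \<noteq> b" using b irrefl by auto
        show ?thesis
        proof (cases "(\<forall>x\<in>V - {a, b}. ex a x = 0) \<and> (\<forall>x\<in>V - {a, b}. ex b x = 0)")
          case True
          have "ex a b + j a + j b \<le> 2"
            using edge inU a b by blast
          then show ?thesis
            using True a b ab irrefl sym[of a b] by (intro remove[of "{a, b}"]) auto
        next
          case False
          then have "\<exists>u v w. u \<in> V \<and> v \<in> V \<and> w \<in> V \<and> distinct [u, v, w] \<and> ex u v > 0 \<and> ex u w > 0"
          proof -
            from False consider x where "x \<in> V - {a, b}" "ex a x > 0"
              | x where "x \<in> V - {a, b}" "ex b x > 0" by blast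
            then show ?thesis
            proof cases
              case (1 x)
              then have "distinct [a, b, x]" using ab by auto
              then show ?thesis using 1 a b by blast
            next
              case (2 x)
              then have "distinct [b, a, x]" "ex b a > 0" using ab b sym by auto
              then show ?thesis using 2 a b by blast
            qed
          qed
          then obtain u v w where uvw: "u \<in> V" "v \<in> V" "w \<in> V" "distinct [u, v, w]"
            "ex u v > 0" "ex u w > 0" by blast
          have dist: "u \<noteq> v" "u \<noteq> w" "v \<noteq> w" using uvw(4) by auto
          have vu: "ex v u > 0" "ex w u > 0" using uvw sym by auto
          \<comment> \<open>Such an \<open>x\<close> would give the path \<open>x\<close>,
            \<open>v\<close>, \<open>u\<close>, \<open>w\<close> with three edges.\<close>
          have nbr_v: "ex v x = 0" if "x \<in> V" "x \<notin> {u, v, w}" for x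
            using path3[of x v u w] sym[of x v] that uvw dist vu inU by fastforce
          have nbr_w: "ex w x = 0" if "x \<in> V" "x \<notin> {u, v, w}" for x
            using path3[of x w u v] sym[of x w] that uvw dist vu inU by fastforce
          show ?thesis
          proof (cases "ex v w > 0")
            case True
            have nbr_u: "ex u x = 0" if "x \<in> V" "x \<notin> {u, v, w}" for x
              using path3[of x u v w] sym[of x u] that uvw dist vu inU True by fastforce
            have j0: "j u = 0" "j v = 0" "j w = 0"
              using triangle[of u v w] triangle[of v u w] triangle[of w u v]
                uvw dist inU True sym[of u v] sym[of u w] sym[of v w] by auto
            have le1: "ex u v \<le> 1" "ex u w \<le> 1" "ex v w \<le> 1"
              using path2[of w u v] path2[of v u w] path2[of u v w]
                uvw dist inU True sym[of u v] sym[of u w] sym[of v w] by auto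
            \<comment> \<open>The triangle has no edges leaving it, no loops, and surplus at most 1
              on each side: weight 3 on three vertices.\<close>
            show ?thesis
            proof (rule remove[of "{u, v, w}"])
              have "(\<Sum>x\<in>{u, v, w}. \<Sum>y\<in>V - {u, v, w}. ex x y) = 0"
                using nbr_u nbr_v nbr_w by simp
              then show "2 * sum j {u, v, w} + (\<Sum>x\<in>{u, v, w}. \<Sum>y\<in>{u, v, w}. ex x y)
                  + 2 * (\<Sum>x\<in>{u, v, w}. \<Sum>y\<in>V - {u, v, w}. ex x y) \<le> 2 * card {u, v, w}"
                using j0 le1 dist irrefl sym[of u v] sym[of u w] sym[of v w] by simp
            qed (use uvw in auto)
          next
            case False
            then have vw: "ex v w = 0" "ex w v = 0" using sym[of v w] by auto
            have "(\<Sum>x\<in>V. ex v x) = (\<Sum>x\<in>{u}. ex v x)"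
              using uvw(1) vw irrefl nbr_v psubset.hyps
              by (intro sum.mono_neutral_right) blast+
            moreover have "ex v u \<le> 1"
              using path2[of w u v] uvw dist inU sym[of u v] sym[of u w] by auto
            ultimately have "j v > 0"
              using big[of v] uvw by simp
            moreover have "(\<Sum>x\<in>V. ex w x) = (\<Sum>x\<in>{u}. ex w x)"
              using uvw(1) vw irrefl nbr_w psubset.hyps
              by (intro sum.mono_neutral_right) blast+
            moreover have "ex w u \<le> 1"
              using path2[of v u w] uvw dist inU sym[of u v] sym[of u w] by auto
            ultimately have "j v > 0" "j w > 0"
              using big[of w] uvw by simp_all
            then show ?thesis
              using leaves[of u v w] uvw inU by blast
          qed
        qed
      qed simp
    qed
  qed
qed

section \<open>Frame matroids as graphs\<close>

text \<open>\<open>M\<close> is the ambient framed matroid; the frame matroid under study is its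
  restriction to \<open>X\<close>. As \<open>B\<close> may miss \<open>X\<close>, its elements serve
  for computing closures but not for forming minors.\<close>

locale framed_restriction = matroid M for M :: "'a set_system" +
  fixes B X :: "'a set"
  assumes basis_B: "basis M B"
    and frame: "\<And>e. e \<in> ground M \<Longrightarrow> \<exists>S \<subseteq> B. card S \<le> 2 \<and> e \<in> cl S"
    and X_subset: "X \<subseteq> ground M"
    and simple: "simple_matroid (restriction M X)"
begin

section \<open>Supports of elements in the frame\<close>

lemma indep_subset_B: "S \<subseteq> B \<Longrightarrow> S \<in> indeps M"
  by (rule indep_mono[of B]) (use basis_B in \<open>simp_all add: basis_def\<close>)

lemma B_subset_ground: "B \<subseteq> ground M"
  by (rule indep_subset_ground[OF indep_subset_B[OF subset_refl]])

lemma finite_B: "finite B"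
  by (rule finite_subset[OF B_subset_ground finite_ground])

lemma finite_X: "finite X"
  by (rule finite_subset[OF X_subset finite_ground])

lemma rank_subset_B: "T \<subseteq> B \<Longrightarrow> rank_of M T = card T"
  by (rule rank_indep[OF indep_subset_B])

text \<open>The subsets of \<open>B\<close> spanning \<open>e\<close> are closed under intersection
  by \<open>cl_Int_indep\<close>, so one of least size is contained in all others. For
  \<open>e\<close> outside \<open>B\<close> it is the fundamental circuit of \<open>e\<close>
  without \<open>e\<close>.\<close>

lemma support_exists:
  assumes "e \<in> ground M"
  shows "\<exists>S. S \<subseteq> B \<and> card S \<le> 2 \<and> (\<forall>T \<subseteq> B. e \<in> cl T \<longleftrightarrow> S \<subseteq> T)"
proof -
  obtain S0 where S0: "S0 \<subseteq> B" "card S0 \<le> 2" "e \<in> cl S0"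
    using frame[OF assms] by blast
  have "\<exists>S. (S \<subseteq> B \<and> e \<in> cl S) \<and> (\<forall>T. T \<subseteq> B \<and> e \<in> cl T \<longrightarrow> card S \<le> card T)"
    by (rule ex_has_least_nat[of _ S0]) (use S0 in simp)
  then obtain S where S: "S \<subseteq> B" "e \<in> cl S"
    and min: "\<And>T. T \<subseteq> B \<Longrightarrow> e \<in> cl T \<Longrightarrow> card S \<le> card T"
    by (elim exE conjE) simp
  have min': "S \<subseteq> T" if T: "T \<subseteq> B" "e \<in> cl T" for T
  proof -
    have "e \<in> cl (S \<inter> T)"
      using S T by (intro cl_Int_indep indep_subset_B) simp_all
    then have "card S \<le> card (S \<inter> T)"
      using min[of "S \<inter> T"] T by blast
    then have "S \<inter> T = S"
      using finite_subset[OF S(1) finite_B] by (intro card_seteq) auto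
    then show ?thesis by blast
  qed
  have mono': "e \<in> cl T" if "S \<subseteq> T" for T
    using cl_mono[OF that] S(2) by (rule subsetD)
  have "e \<in> cl T \<longleftrightarrow> S \<subseteq> T" if "T \<subseteq> B" for T
    using min'[OF that] mono'[of T] by (rule iffI)
  moreover have "card S \<le> 2" using min[OF S0(1,3)] S0(2) by (rule order_trans)
  ultimately show ?thesis using S(1) by (intro exI[of _ S]) simp
qed

definition supp :: "'a \<Rightarrow> 'a set" where
  "supp e = (SOME S. S \<subseteq> B \<and> card S \<le> 2 \<and> (\<forall>T \<subseteq> B. e \<in> cl T \<longleftrightarrow> S \<subseteq> T))"

lemma supp:
  assumes "e \<in> ground M"
  shows "supp e \<subseteq> B" "card (supp e) \<le> 2" "\<And>T. T \<subseteq> B \<Longrightarrow> e \<in> cl T \<longleftrightarrow> supp e \<subseteq> T"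
proof -
  have "supp e \<subseteq> B \<and> card (supp e) \<le> 2 \<and> (\<forall>T \<subseteq> B. e \<in> cl T \<longleftrightarrow> supp e \<subseteq> T)"
    unfolding supp_def by (rule someI_ex[OF support_exists[OF assms]])
  then show "supp e \<subseteq> B" "card (supp e) \<le> 2" "\<And>T. T \<subseteq> B \<Longrightarrow> e \<in> cl T \<longleftrightarrow> supp e \<subseteq> T"
    by simp_all
qed

text \<open>In terms of the gain graph on the vertex set \<open>B\<close>: the edges between \<open>u\<close> and \<open>v\<close>, or the
  loops (at most one, as the restriction is simple) at \<open>v\<close> if \<open>u = v\<close>.\<close>

definition edges :: "'a \<Rightarrow> 'a \<Rightarrow> 'a set" where
  "edges u v = {e \<in> X. supp e = {u, v}}"

lemma edges_subset: "edges u v \<subseteq> X"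
  by (auto simp: edges_def)

lemma edges_commute: "edges u v = edges v u"
  by (auto simp: edges_def insert_commute)

lemma finite_edges: "finite (edges u v)"
  by (rule finite_subset[OF edges_subset finite_X])

lemma edges_ground: "e \<in> edges u v \<Longrightarrow> e \<in> ground M"
  using X_subset by (auto simp: edges_def)

lemma edges_ends: "e \<in> edges u v \<Longrightarrow> u \<in> B \<and> v \<in> B"
  using supp(1)[OF edges_ground[of e u v]] by (auto simp: edges_def)

lemma edges_cl: "e \<in> edges u v \<Longrightarrow> T \<subseteq> B \<Longrightarrow> e \<in> cl T \<longleftrightarrow> u \<in> T \<and> v \<in> T"
  using supp(3)[OF edges_ground[of e u v], of T] by (simp add: edges_def)

text \<open>The case \<open>e = f\<close> is included; it says that \<open>X\<close> contains no
  loops of the matroid.\<close>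

lemma indep_pair:
  assumes "e \<in> X" "f \<in> X"
  shows "{e, f} \<in> indeps M"
proof -
  have gr: "e \<in> ground (restriction M X)" "f \<in> ground (restriction M X)"
    using assms X_subset by (auto simp: restriction_def)
  have "{e} \<in> indeps (restriction M X)" "{f} \<in> indeps (restriction M X)"
    using simple gr by (auto simp: simple_matroid_def loop_def)
  then have "{e, f} \<in> indeps (restriction M X)"
    using simple gr by (cases "e = f") (auto simp: simple_matroid_def loop_def parallel_pair_def)
  then show ?thesis by (simp add: restriction_def)
qed

lemma rank_pair: "e \<in> X \<Longrightarrow> f \<in> X \<Longrightarrow> e \<noteq> f \<Longrightarrow> rank_of M {e, f} = 2"
  using rank_indep[OF indep_pair, of e f] by simp

lemma supp_nonempty: "e \<in> X \<Longrightarrow> supp e \<noteq> {}"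
proof
  assume e: "e \<in> X" "supp e = {}"
  then have "e \<in> cl {}" using supp(3)[of e "{}"] X_subset by auto
  then show False
    using rank_indep[OF indep_pair[OF e(1) e(1)]] by (simp add: closure_of_set_def)
qed

text \<open>By simplicity two parallel edges have rank 2, which is at least the rank of their ends,
  so they span the ends in turn.\<close>

lemma span_ends:
  assumes "e \<in> edges u v" "e' \<in> edges u v" "e \<noteq> e'" "e \<in> A" "e' \<in> A"
  shows "u \<in> cl A" "v \<in> cl A"
proof -
  have uv: "{u, v} \<subseteq> B" using edges_ends[OF assms(1)] by simp
  have "{u, v} \<subseteq> cl {e, e'}"
  proof (rule in_cl_of_rank_eq)
    show "{e, e'} \<subseteq> cl {u, v}"
      using edges_cl[OF assms(1) uv] edges_cl[OF assms(2) uv] by simp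
    have "card {u, v} \<le> 2" by (simp add: card_insert_if)
    then have "rank_of M {u, v} \<le> 2"
      using rank_le_card[of "{u, v}"] by simp
    also have "2 = rank_of M {e, e'}"
      by (rule rank_pair[OF subsetD[OF edges_subset assms(1)] subsetD[OF edges_subset assms(2)] assms(3), symmetric])
    finally show "rank_of M {u, v} \<le> rank_of M {e, e'}" .
    show "{u, v} \<subseteq> ground M" using uv B_subset_ground by (rule subset_trans)
  qed
  also have "cl {e, e'} \<subseteq> cl A" using assms by (intro cl_mono) auto
  finally show "u \<in> cl A" "v \<in> cl A" by auto
qed

text \<open>Exchange: \<open>e\<close> lies in the closure of both ends but not of \<open>u\<close>
  alone. Contracting \<open>e\<close> thus identifies its two ends.\<close>

lemma span_other_end:
  assumes "e \<in> edges u v" "e \<in> cl A" "u \<in> cl A" "u \<noteq> v"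
  shows "v \<in> cl A"
proof -
  have uv: "u \<in> B" "v \<in> B" using edges_ends[OF assms(1)] by simp_all
  have "v \<in> cl (insert e {u})"
    by (rule cl_exchange) (use edges_cl[OF assms(1), of "{v, u}"] edges_cl[OF assms(1), of "{u}"]
      assms(4) uv B_subset_ground in auto)
  moreover have "cl (insert e {u}) \<subseteq> cl A" by (rule cl_subset_cl) (use assms in auto)
  ultimately show ?thesis by blast
qed

lemma span_joint_end:
  assumes "e \<in> edges v v" "e \<in> cl A"
  shows "v \<in> cl A"
proof -
  have v: "v \<in> B" using edges_ends[OF assms(1)] by simp
  have "v \<in> cl (insert e {})"
    by (rule cl_exchange) (use edges_cl[OF assms(1), of "{v}"] edges_cl[OF assms(1), of "{}"]
      v B_subset_ground in auto)
  moreover have "cl (insert e {}) \<subseteq> cl A" by (rule cl_subset_cl) (use assms in auto)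
  ultimately show ?thesis by blast
qed

lemma card_joints_le: "card (edges v v) \<le> 1"
proof -
  have "e = f" if e: "e \<in> edges v v" and f: "f \<in> edges v v" for e f
  proof (rule ccontr)
    assume "e \<noteq> f"
    have "{e, f} \<subseteq> cl {v}"
      using edges_ends[OF e] edges_cl[OF e, of "{v}"] edges_cl[OF f, of "{v}"] by simp
    then have "rank_of M {e, f} \<le> rank_of M {v}" by (rule rank_le_of_subset_cl)
    moreover have "rank_of M {e, f} = 2"
      by (rule rank_pair[OF subsetD[OF edges_subset e] subsetD[OF edges_subset f] \<open>e \<noteq> f\<close>])
    ultimately show False using rank_le_card[of "{v}"] by simp
  qed
  then show ?thesis
    by (simp add: card_le_Suc0_iff_eq[OF finite_edges])
qed

end

text \<open>\<open>k\<close> stands for \<open>l - 1\<close>, so that \<open>k + 3\<close> is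
  \<open>l + 2\<close> without subtraction, and a pair is heavy when it carries more than
  \<open>k\<close> edges.\<close>

locale short_lines = framed_restriction +
  fixes k :: nat
  assumes no_line: "\<not> has_minor (restriction M X) (uniform_matroid 2 (k + 3))"
begin

text \<open>Contracting \<open>C\<close> turns the elements of \<open>P\<close> and \<open>Q\<close> into loops at \<open>u\<close> and \<open>w\<close>.\<close>

lemma card_edges_plus_joints_le:
  assumes uw: "u \<in> T" "w \<in> T" "u \<noteq> w" and T: "T \<subseteq> B" "card T = card C + 2"
    and sub: "C \<subseteq> X" "P \<subseteq> X" "Q \<subseteq> X" and le1: "card P \<le> 1" "card Q \<le> 1"
    and CT: "C \<union> P \<union> Q \<subseteq> cl T" and TC: "T \<subseteq> cl ({u, w} \<union> C)"
    and P: "\<And>p. p \<in> P \<Longrightarrow> u \<in> cl (insert p C)"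
    and Q: "\<And>q. q \<in> Q \<Longrightarrow> w \<in> cl (insert q C)"
    and disj: "C \<inter> edges u w = {}" "C \<inter> (P \<union> Q) = {}" "P \<inter> Q = {}" "(P \<union> Q) \<inter> edges u w = {}"
  shows "card (edges u w) + card P + card Q \<le> k + 2"
proof (rule ccontr)
  assume gt: "\<not> ?thesis"
  define Z where "Z = edges u w \<union> P \<union> Q"
  have fin: "finite P" "finite Q" "finite C"
    using sub by (simp_all add: finite_subset[OF _ finite_X])
  have "card Z = card (edges u w) + card P + card Q"
    unfolding Z_def using disj fin finite_edges
    by (subst card_Un_disjoint; (subst card_Un_disjoint)?) auto
  then obtain Y where Y: "Y \<subseteq> Z" "card Y = k + 3"
    using obtain_subset_with_card_n[of "k + 3" Z] gt by auto
  have ZX: "Z \<subseteq> X" unfolding Z_def using sub edges_subset by blast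
  have CX: "C \<subseteq> ground M" using sub X_subset by blast
  \<comment> \<open>Any two elements of \<open>Z\<close>, together with \<open>C\<close>, span
    \<open>u\<close> and \<open>w\<close> and thereby all of \<open>T\<close>. So they are
    independent after contracting \<open>C\<close>.\<close>
  have pair: "card C + 2 \<le> rank_of M ({x, y} \<union> C)" if xy: "x \<in> Z" "y \<in> Z" "x \<noteq> y" for x y
  proof -
    let ?A = "{x, y} \<union> C"
    have Aground: "?A \<subseteq> ground M" using xy ZX CX X_subset by blast
    have A: "x \<in> cl ?A" "y \<in> cl ?A" using cl_superset[OF Aground] by auto
    have mono: "cl (insert x C) \<subseteq> cl ?A" "cl (insert y C) \<subseteq> cl ?A"
      by (intro cl_mono; auto)+
    have "u \<in> cl ?A \<and> w \<in> cl ?A"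
    proof (cases "x \<in> edges u w \<and> y \<in> edges u w")
      case True
      then show ?thesis using span_ends[of x u w y ?A] xy by auto
    next
      case False
      have iff: "u \<in> cl ?A \<longleftrightarrow> w \<in> cl ?A" if "x \<in> edges u w \<or> y \<in> edges u w"
        using that span_other_end[of x u w ?A] span_other_end[of x w u ?A]
          span_other_end[of y u w ?A] span_other_end[of y w u ?A] A uw(3)
          edges_commute[of u w] by auto
      have PA: "u \<in> cl ?A" if "x \<in> P \<or> y \<in> P"
        using that P mono by blast
      have QA: "w \<in> cl ?A" if "x \<in> Q \<or> y \<in> Q"
        using that Q mono by blast
      \<comment> \<open>Two elements of \<open>P\<close> would give only \<open>u\<close>. As that
        is excluded, every remaining choice reaches both ends, an edge carrying one end to the
        other.\<close>
      have "\<not> (x \<in> P \<and> y \<in> P)" "\<not> (x \<in> Q \<and> y \<in> Q)"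
        using xy(3) le1 fin card_le_Suc0_iff_eq[of P] card_le_Suc0_iff_eq[of Q] by auto
      then show ?thesis using xy False iff PA QA unfolding Z_def by blast
    qed
    then have "{u, w} \<union> C \<subseteq> cl ?A"
      using cl_superset[OF Aground] by blast
    then have "T \<subseteq> cl ?A"
      using TC cl_subset_cl by blast
    then show ?thesis
      using rank_le_of_subset_cl[of T ?A] rank_subset_B[OF T(1)] T(2) by simp
  qed
  have "\<not> card Y \<le> 1" using Y by simp
  then obtain x y where xy: "x \<in> Y" "y \<in> Y" "x \<noteq> y"
    using card_le_Suc0_iff_eq[of Y] Y card.infinite[of Y] by fastforce
  have "card C + 2 \<le> rank_of M C + 2"
    using pair[OF subsetD[OF Y(1) xy(1)] subsetD[OF Y(1) xy(2)] xy(3)] rank_Un_le[of "{x, y}" C] xy(3)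
    by simp
  \<comment> \<open>\<open>C\<close> is independent because two elements raise its rank by at most
    2, yet reach rank \<open>card C + 2\<close>.\<close>
  then have rC: "rank_of M C = card C"
    using rank_le_card[OF fin(3)] by simp
  interpret N: matroid "restriction M X" by (rule matroid_restriction)
  have "edges u w \<subseteq> cl T"
    using edges_cl[of _ u w T] uw T by auto
  then have "Y \<union> C \<subseteq> cl T"
    using CT Y unfolding Z_def by blast
  then have "rank_of M (Y \<union> C) \<le> rank_of M C + 2"
    using rank_le_of_subset_cl[of "Y \<union> C" T] rank_subset_B[OF T(1)] T(2) rC by simp
  then have "has_minor (restriction M X) (uniform_matroid 2 (card Y))"
  proof (intro N.has_line_minorI[of C])
    have YX: "Y \<subseteq> X" using Y ZX by blast
    then have YCX: "Y \<union> C \<subseteq> X" using sub by blast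
    show "C \<subseteq> ground (restriction M X)" "Y \<subseteq> ground (restriction M X)"
      using YX sub X_subset by (auto simp: restriction_def)
    show "C \<inter> Y = {}" using Y(1) disj unfolding Z_def by blast
    show "2 \<le> card Y" using Y(2) by simp
    show "rank_of (restriction M X) (Y \<union> C) \<le> rank_of (restriction M X) C + 2"
      using \<open>rank_of M (Y \<union> C) \<le> rank_of M C + 2\<close> by (simp only: rank_restriction[OF YCX] rank_restriction[OF sub(1)])
    show "rank_of (restriction M X) C + 2 \<le> rank_of (restriction M X) ({x, y} \<union> C)"
      if "x \<in> Y" "y \<in> Y" "x \<noteq> y" for x y
    proof -
      have "{x, y} \<union> C \<subseteq> X" using that YCX by blast
      then show ?thesis
        using pair[OF subsetD[OF Y(1) that(1)] subsetD[OF Y(1) that(2)] that(3)]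
        by (simp only: rank_restriction rank_restriction[OF sub(1)] rC)
    qed
  qed
  then show False using no_line Y by simp
qed

section \<open>Bounds on the edges of a pair from loops at its ends\<close>

lemma obtain_two_edges:
  assumes "card (edges u v) \<ge> 2"
  obtains e e' where "e \<in> edges u v" "e' \<in> edges u v" "e \<noteq> e'"
  using assms card_le_Suc0_iff_eq[OF finite_edges, of u v] by force

text \<open>Nothing is contracted: the edges and the loops at both ends already lie on the line
  through \<open>u\<close> and \<open>v\<close>.\<close>

lemma card_edges_joints:
  assumes "u \<in> B" "v \<in> B" "u \<noteq> v"
  shows "card (edges u v) + card (edges u u) + card (edges v v) \<le> k + 2"
proof (rule card_edges_plus_joints_le[where C = "{}" and T = "{u, v}"])
  show "edges u u \<inter> edges v v = {}" "(edges u u \<union> edges v v) \<inter> edges u v = {}"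
    using assms by (auto simp: edges_def doubleton_eq_iff)
  show "u \<in> cl (insert p {})" if "p \<in> edges u u" for p
    using span_joint_end[OF that, of "{p}"] cl_superset[of "{p}"] edges_ground[OF that] by auto
  show "v \<in> cl (insert p {})" if "p \<in> edges v v" for p
    using span_joint_end[OF that, of "{p}"] cl_superset[of "{p}"] edges_ground[OF that] by auto
  show "{u, v} \<subseteq> cl ({u, v} \<union> {})"
    using cl_superset[of "{u, v}"] assms B_subset_ground by auto
  show "{} \<union> edges u u \<union> edges v v \<subseteq> cl {u, v}"
    using edges_cl[of _ u u "{u, v}"] edges_cl[of _ v v "{u, v}"] assms by auto
qed (use assms card_joints_le edges_subset in auto)

text \<open>Contracting \<open>e\<close> turns \<open>e'\<close> into a loop at \<open>v\<close>,
  which takes one of the \<open>k + 2\<close> places on the line through \<open>v\<close> and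
  \<open>w\<close>.\<close>

lemma card_edges_adjacent:
  assumes "distinct [u, v, w]" "card (edges u v) \<ge> 2" "w \<in> B"
  shows "card (edges v w) \<le> k + 1"
proof -
  obtain e e' where e: "e \<in> edges u v" "e' \<in> edges u v" "e \<noteq> e'"
    using obtain_two_edges[OF assms(2)] by blast
  have inB: "u \<in> B" "v \<in> B" using edges_ends[OF e(1)] by auto
  have "card (edges v w) + card {e'} + card ({} :: 'a set) \<le> k + 2"
  proof (rule card_edges_plus_joints_le[where C = "{e}" and T = "{u, v, w}"])
    have "{v, w} \<union> {e} \<subseteq> ground M"
      using inB assms(3) B_subset_ground edges_ground[OF e(1)] by auto
    from cl_superset[OF this] have "{v, w, e} \<subseteq> cl ({v, w} \<union> {e})"
      by simp
    then show "{u, v, w} \<subseteq> cl ({v, w} \<union> {e})"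
      using span_other_end[of e v u "{v, w} \<union> {e}"] e assms edges_commute[of u v] by auto
    show "v \<in> cl (insert p {e})" if "p \<in> {e'}" for p
      using span_ends[of e u v e' "{e', e}"] e that by auto
    show "{e} \<inter> edges v w = {}" "({e'} \<union> {}) \<inter> edges v w = {}"
      using e assms(1) by (auto simp: edges_def doubleton_eq_iff)
    show "{e} \<union> {e'} \<union> {} \<subseteq> cl {u, v, w}"
      using edges_cl[OF e(1), of "{u, v, w}"] edges_cl[OF e(2), of "{u, v, w}"] inB assms(3) by auto
  qed (use inB assms e subsetD[OF edges_subset e(1)] subsetD[OF edges_subset e(2)] in auto)
  then show ?thesis by simp
qed

text \<open>Contracting one edge at each end of the path creates loops at both \<open>u\<close> and
  \<open>v\<close>; these take two of the \<open>k + 2\<close> places.\<close>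

lemma no_heavy_path:
  assumes "distinct [a, u, v, b]" "card (edges a u) \<ge> 2" "card (edges v b) \<ge> 2"
  shows "card (edges u v) \<le> k"
proof -
  obtain e e' where e: "e \<in> edges a u" "e' \<in> edges a u" "e \<noteq> e'"
    using obtain_two_edges[OF assms(2)] by blast
  obtain g g' where g: "g \<in> edges v b" "g' \<in> edges v b" "g \<noteq> g'"
    using obtain_two_edges[OF assms(3)] by blast
  have inB: "a \<in> B" "u \<in> B" "v \<in> B" "b \<in> B"
    using edges_ends[OF e(1)] edges_ends[OF g(1)] by auto
  have ne: "e \<noteq> g" "e \<noteq> g'" "e' \<noteq> g" "e' \<noteq> g'"
    using e g assms(1) by (auto simp: edges_def doubleton_eq_iff)
  have "card (edges u v) + card {e'} + card {g'} \<le> k + 2"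
  proof (rule card_edges_plus_joints_le[where C = "{e, g}" and T = "{a, u, v, b}"])
    let ?A = "{u, v} \<union> {e, g}"
    have "?A \<subseteq> ground M"
      using inB B_subset_ground edges_ground[OF e(1)] edges_ground[OF g(1)] by auto
    from cl_superset[OF this] have "{u, v, e, g} \<subseteq> cl ?A"
      by simp
    then show "{a, u, v, b} \<subseteq> cl ?A"
      using span_other_end[of e u a ?A] span_other_end[of g v b ?A] e g assms(1)
        edges_commute[of u a] by auto
    show "u \<in> cl (insert p {e, g})" if "p \<in> {e'}" for p
      using span_ends[of e a u e' "{e', e, g}"] e that by auto
    show "v \<in> cl (insert q {e, g})" if "q \<in> {g'}" for q
      using span_ends[of g v b g' "{g', e, g}"] g that by auto
    show "{e, g} \<inter> edges u v = {}" "({e'} \<union> {g'}) \<inter> edges u v = {}"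
      using e g assms(1) by (auto simp: edges_def doubleton_eq_iff)
    show "{e, g} \<union> {e'} \<union> {g'} \<subseteq> cl {a, u, v, b}"
      using edges_cl[OF e(1), of "{a, u, v, b}"] edges_cl[OF e(2), of "{a, u, v, b}"]
        edges_cl[OF g(1), of "{a, u, v, b}"] edges_cl[OF g(2), of "{a, u, v, b}"] inB by auto
  qed (use inB assms(1) e(3) g(3) ne subsetD[OF edges_subset e(1)] subsetD[OF edges_subset e(2)]
      subsetD[OF edges_subset g(1)] subsetD[OF edges_subset g(2)] in auto)
  then show ?thesis by simp
qed

text \<open>Contracting an edge between \<open>u\<close> and \<open>v\<close> moves the loop from
  \<open>v\<close> to \<open>u\<close>. The pair \<open>u\<close>, \<open>w\<close> then has a loop
  at each end.\<close>

lemma no_joints_at_heavy_leaves: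
  assumes "distinct [u, v, w]" "edges u v \<noteq> {}" "edges v v \<noteq> {}" "edges w w \<noteq> {}"
  shows "card (edges u w) \<le> k"
proof -
  obtain e p q where e: "e \<in> edges u v" and p: "p \<in> edges v v" and q: "q \<in> edges w w"
    using assms by blast
  have inB: "u \<in> B" "v \<in> B" "w \<in> B"
    using edges_ends[OF e] edges_ends[OF q] by auto
  have ne: "e \<noteq> p" "e \<noteq> q" "p \<noteq> q"
    using e p q assms(1) by (auto simp: edges_def doubleton_eq_iff)
  have gr: "e \<in> ground M" "p \<in> ground M" "q \<in> ground M"
    using e p q edges_ground by blast+
  have "card (edges u w) + card {p} + card {q} \<le> k + 2"
  proof (rule card_edges_plus_joints_le[where C = "{e}" and T = "{u, v, w}"])
    let ?A = "{u, w} \<union> {e}"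
    have "{u, w, e} \<subseteq> cl ?A"
      using cl_superset[of ?A] inB B_subset_ground gr by auto
    then show "{u, v, w} \<subseteq> cl ?A"
      using span_other_end[of e u v ?A] e assms(1) by auto
    have "{p, e} \<subseteq> cl {p, e}" "{q, e} \<subseteq> cl {q, e}"
      using cl_superset[of "{p, e}"] cl_superset[of "{q, e}"] gr by simp_all
    then show "u \<in> cl (insert p' {e})" if "p' \<in> {p}" for p'
      using span_joint_end[OF p, of "{p, e}"] span_other_end[of e v u "{p, e}"]
        e assms(1) edges_commute[of u v] that by auto
    show "w \<in> cl (insert q' {e})" if "q' \<in> {q}" for q'
      using span_joint_end[OF q, of "{q, e}"] \<open>{q, e} \<subseteq> cl {q, e}\<close> that by auto
    show "{e} \<inter> edges u w = {}" "({p} \<union> {q}) \<inter> edges u w = {}"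
      using e p q assms(1) by (auto simp: edges_def doubleton_eq_iff)
    show "{e} \<union> {p} \<union> {q} \<subseteq> cl {u, v, w}"
      using edges_cl[OF e, of "{u, v, w}"] edges_cl[OF p, of "{u, v, w}"]
        edges_cl[OF q, of "{u, v, w}"] inB by auto
  qed (use inB assms(1) ne subsetD[OF edges_subset e] subsetD[OF edges_subset p]
      subsetD[OF edges_subset q] in auto)
  then show ?thesis by simp
qed

text \<open>Contracting one edge between \<open>v\<close> and \<open>w\<close> makes a parallel one
  a loop at \<open>v\<close>. With the loop at \<open>u\<close>, the pair \<open>u\<close>,
  \<open>v\<close> has loops at both ends.\<close>

lemma no_joint_at_heavy_triangle:
  assumes "distinct [u, v, w]" "card (edges v w) \<ge> 2" "edges u u \<noteq> {}"
  shows "card (edges u v) \<le> k"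
proof -
  obtain e e' where e: "e \<in> edges v w" "e' \<in> edges v w" "e \<noteq> e'"
    using obtain_two_edges[OF assms(2)] by blast
  obtain p where p: "p \<in> edges u u" using assms by blast
  have inB: "u \<in> B" "v \<in> B" "w \<in> B"
    using edges_ends[OF e(1)] edges_ends[OF p] by auto
  have ne: "e \<noteq> p" "e' \<noteq> p"
    using e p assms(1) by (auto simp: edges_def doubleton_eq_iff)
  have gr: "e \<in> ground M" "p \<in> ground M"
    using e p edges_ground by blast+
  have "card (edges u v) + card {p} + card {e'} \<le> k + 2"
  proof (rule card_edges_plus_joints_le[where C = "{e}" and T = "{u, v, w}"])
    let ?A = "{u, v} \<union> {e}"
    have "{u, v, e} \<subseteq> cl ?A"
      using cl_superset[of ?A] inB B_subset_ground gr by auto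
    then show "{u, v, w} \<subseteq> cl ?A"
      using span_other_end[of e v w ?A] e assms(1) by auto
    show "u \<in> cl (insert p' {e})" if "p' \<in> {p}" for p'
      using span_joint_end[OF p, of "{p, e}"] cl_superset[of "{p, e}"] gr that by auto
    show "v \<in> cl (insert q {e})" if "q \<in> {e'}" for q
      using span_ends[of e v w e' "{e', e}"] e that by auto
    show "{e} \<inter> edges u v = {}" "({p} \<union> {e'}) \<inter> edges u v = {}"
      using e p assms(1) by (auto simp: edges_def doubleton_eq_iff)
    show "{e} \<union> {p} \<union> {e'} \<subseteq> cl {u, v, w}"
      using edges_cl[OF e(1), of "{u, v, w}"] edges_cl[OF e(2), of "{u, v, w}"]
        edges_cl[OF p, of "{u, v, w}"] inB by auto
  qed (use inB assms(1) e(3) ne subsetD[OF edges_subset e(1)] subsetD[OF edges_subset e(2)]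
      subsetD[OF edges_subset p] in auto)
  then show ?thesis by simp
qed

end

text \<open>A frame can be much larger than the rank of \<open>X\<close>, while the counting is by
  frame elements. Completing a basis \<open>I\<close> of \<open>X\<close> by
  \<open>D \<subseteq> B\<close> yields a set \<open>D\<close> skew to \<open>X\<close>. Contracting
  \<open>D\<close> leaves independence inside \<open>X\<close> unchanged, and \<open>B - D\<close>
  frames the contraction with as many elements as \<open>I\<close>.\<close>

lemma (in matroid) frame_restriction_spanning:
  assumes "framed_by M B" "X \<subseteq> ground M"
  shows "\<exists>(M' :: 'a set_system) B'. framed_by M' B' \<and> X \<subseteq> ground M' \<and>
    restriction M' X = restriction M X \<and> card B' = rank_of M X"
proof -
  have B: "basis M B" and fr: "\<And>e. e \<in> ground M \<Longrightarrow> \<exists>S \<subseteq> B. card S \<le> 2 \<and> e \<in> cl S"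
    using assms(1) by (auto simp: framed_by_def)
  have indB: "B \<in> indeps M" and finB: "finite B"
    using B indep_finite by (auto simp: basis_def)
  obtain I where I: "I \<in> indeps M" "I \<subseteq> X" "card I = rank_of M X"
    using rank_attained by blast
  have "card I \<le> card B"
    using card_le_rank[OF I(1), of "ground M"] I assms(2) basis_card_eq_rank[OF B]
    by (auto simp: matroid_rank_def)
  then obtain D where D: "D \<subseteq> B - I" "I \<union> D \<in> indeps M" "card (I \<union> D) = card B"
    using indep_extend_by[OF I(1) indB] by blast
  have finD: "finite D" using D finB finite_subset by blast
  have cardD: "card B = card I + card D"
    using D indep_finite[OF I(1)] finD by (metis Diff_disjoint card_Un_disjoint inf.absorb_iff2 inf_assoc inf_bot_right inf_commute)
  have rD: "rank_of M D = card D"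
    using D indep_mono by (intro rank_indep) blast
  have XI: "X \<subseteq> cl I"
  proof
    fix x assume x: "x \<in> X"
    then have "rank_of M (insert x I) \<le> rank_of M X"
      using I by (intro rank_mono) auto
    then have "rank_of M (insert x I) = rank_of M I"
      using I rank_indep[OF I(1)] rank_mono[OF subset_insertI[of I x]] by simp
    then show "x \<in> cl I" using x assms(2) by (auto simp: closure_of_set_def)
  qed
  \<comment> \<open>Skewness passes from \<open>X\<close> to its subsets: by submodularity, a loss
    of rank at \<open>A\<close> would persist at \<open>X\<close>.\<close>
  have rXD: "rank_of M (A \<union> D) = rank_of M A + card D" if A: "A \<subseteq> X" for A
  proof -
    have "I \<union> D \<subseteq> cl (X \<union> D)"
      using cl_superset[of "X \<union> D"] I D(2) indep_subset_ground assms(2) by blast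
    then have "card I + card D \<le> rank_of M (X \<union> D)"
      using rank_le_of_subset_cl rank_indep[OF D(2)] D(3) cardD by metis
    moreover have "rank_of M (X \<union> (A \<union> D)) + rank_of M (X \<inter> (A \<union> D)) \<le> rank_of M X + rank_of M (A \<union> D)"
      by (rule rank_submodular)
    moreover have "X \<union> (A \<union> D) = X \<union> D" using A by blast
    moreover have "rank_of M A \<le> rank_of M (X \<inter> (A \<union> D))"
      using A by (intro rank_mono) auto
    ultimately have "rank_of M A + card D \<le> rank_of M (A \<union> D)" using I(3) by simp
    moreover have "rank_of M (A \<union> D) \<le> rank_of M A + card D"
      using rank_Un_le[OF finD, of A] by (simp add: Un_commute)
    ultimately show ?thesis by simp
  qed
  have XD: "X \<inter> D = {}"
  proof (rule ccontr)
    assume "X \<inter> D \<noteq> {}"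
    then obtain d where d: "d \<in> X" "d \<in> D" by blast
    then have "rank_of M ({d} \<union> D) = rank_of M {d} + card D" using rXD[of "{d}"] by blast
    moreover have "{d} \<in> indeps M" using d D indep_mono[OF D(2), of "{d}"] by blast
    ultimately show False using d rank_indep[of "{d}"] rD by (simp add: insert_absorb)
  qed
  let ?M = "contraction M D"
  interpret N: matroid ?M by (rule matroid_contraction)
  have gr: "ground ?M = ground M - D" by (simp add: contraction_def)
  have clN: "e \<in> closure_of_set ?M A" if "A \<subseteq> ground M - D" "e \<in> ground M - D" "e \<in> cl (A \<union> D)" for A e
    using that rank_contraction[of A D] rank_contraction[of "insert e A" D] gr
    by (simp add: closure_of_set_def)
  have DB: "D \<subseteq> B" using D(1) by blast
  have un: "B - D \<union> D = B" "ground M - D \<union> D = ground M"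
    using DB indep_subset_ground[OF indB] by auto
  have card: "card (B - D) + card D = card B"
    using card_Diff_subset[OF finD DB] card_mono[OF finB DB] by simp
  have BD: "B - D \<subseteq> ground M - D" using indB indep_subset_ground by blast
  have fB: "framed_by ?M (B - D)"
    unfolding framed_by_def
  proof (intro conjI ballI N.basis_if_card)
    show "matroid ?M" by (rule N.matroid_axioms)
    show "B - D \<in> indeps ?M"
      using BD un card rD rank_indep[OF indB] by (simp add: indep_contraction_iff)
    show "card (B - D) = matroid_rank ?M"
      using rank_contraction[of "ground M - D" D] un card rD basis_card_eq_rank[OF B] gr
      by (simp add: matroid_rank_def)
    fix e assume e: "e \<in> ground ?M"
    then obtain S where S: "S \<subseteq> B" "card S \<le> 2" "e \<in> cl S"
      using fr[of e] gr by blast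
    \<comment> \<open>The part of \<open>S\<close> inside \<open>D\<close> is contracted away, so
      what is left of \<open>S\<close> still spans \<open>e\<close>.\<close>
    have "e \<in> closure_of_set ?M (S - D)"
    proof (rule clN)
      show "e \<in> cl (S - D \<union> D)" using S(3) cl_mono[of S "S - D \<union> D"] by blast
    qed (use S BD e gr in auto)
    moreover have "card (S - D) \<le> 2"
      using S(2) card_mono[of S "S - D"] finite_subset[OF S(1) finB] by auto
    ultimately show "\<exists>S\<subseteq>B - D. card S \<le> 2 \<and> e \<in> closure_of_set ?M S"
      using S(1) by (intro exI[of _ "S - D"]) auto
  qed
  have "I' \<in> indeps ?M \<longleftrightarrow> I' \<in> indeps M" if "I' \<subseteq> X" for I'
  proof -
    have "I' \<subseteq> ground M - D"
      using that assms(2) XD by blast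
    moreover from this have "finite I'"
      by (meson Diff_subset finite_ground finite_subset)
    ultimately show ?thesis
      using rXD[OF that] rD by (auto simp: indep_contraction_iff indep_iff_rank)
  qed
  then have "{I' \<in> indeps ?M. I' \<subseteq> X} = {I' \<in> indeps M. I' \<subseteq> X}" by blast
  moreover have "ground ?M \<inter> X = ground M \<inter> X" using XD gr by blast
  ultimately have "restriction ?M X = restriction M X"
    by (simp add: restriction_def)
  moreover have "card (B - D) = rank_of M X"
    using card cardD I(3) by simp
  ultimately show ?thesis
    using fB gr XD assms(2) by (intro exI[of _ ?M] exI[of _ "B - D"]) auto
qed

section \<open>The upper bound\<close>

context framed_restriction
begin

text \<open>An element with two ends is met in both orders of the double sum. A loop is met once
  there, on the diagonal, and once in the additional sum.\<close>

lemma double_card_X: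
  "2 * card X = (\<Sum>u\<in>B. \<Sum>v\<in>B. card (edges u v)) + (\<Sum>v\<in>B. card (edges v v))"
proof -
  have card_edges: "card (edges u v) = (\<Sum>e\<in>X. of_bool (supp e = {u, v}))" for u v
    using finite_X by (simp add: edges_def sum_of_bool_eq Int_def)
  have two: "(\<Sum>u\<in>B. \<Sum>v\<in>B. of_bool (supp e = {u, v})) + (\<Sum>v\<in>B. of_bool (supp e = {v, v})) = (2 :: nat)"
    if e: "e \<in> X" for e
  proof -
    have s: "supp e \<subseteq> B" "card (supp e) \<le> 2" "supp e \<noteq> {}"
      using supp(1,2)[of e] supp_nonempty[OF e] e X_subset by auto
    have "finite (supp e)" using s(1) finite_B by (rule finite_subset)
    then have "card (supp e) = 1 \<or> card (supp e) = 2"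
      using s(2,3) card_0_eq[of "supp e"] by linarith
    then obtain a b where ab: "supp e = {a, b}"
    proof
      assume "card (supp e) = 1"
      then obtain a where "supp e = {a}" by (rule card_1_singletonE)
      then show ?thesis using that[of a a] by simp
    next
      assume "card (supp e) = 2"
      then show ?thesis using that by (auto simp: card_2_iff)
    qed
    have inB: "a \<in> B" "b \<in> B" using s ab by auto
    have "(\<Sum>u\<in>B. \<Sum>v\<in>B. of_bool (supp e = {u, v})) = (\<Sum>p\<in>B \<times> B. of_bool (supp e = {fst p, snd p}) :: nat)"
      by (simp add: sum.cartesian_product case_prod_unfold)
    also have "\<dots> = card ((B \<times> B) \<inter> {p. supp e = {fst p, snd p}})"
      using finite_B by (simp add: sum_of_bool_eq)
    also have "(B \<times> B) \<inter> {p. supp e = {fst p, snd p}} = {(a, b), (b, a)}"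
      using inB unfolding ab by (auto simp: doubleton_eq_iff)
    finally have 1: "(\<Sum>u\<in>B. \<Sum>v\<in>B. of_bool (supp e = {u, v})) = card {(a, b), (b, a)}" .
    have "(\<Sum>v\<in>B. of_bool (supp e = {v, v})) = card (B \<inter> {v. supp e = {v, v}})"
      using finite_B by (simp add: sum_of_bool_eq)
    also have "B \<inter> {v. supp e = {v, v}} = (if a = b then {a} else {})"
      using inB unfolding ab by auto
    finally have 2: "(\<Sum>v\<in>B. of_bool (supp e = {v, v})) = card (if a = b then {a} else {})" .
    show ?thesis
      unfolding 1 2 by (cases "a = b") simp_all
  qed
  have "2 * card X = (\<Sum>e\<in>X. (\<Sum>u\<in>B. \<Sum>v\<in>B. of_bool (supp e = {u, v})) + (\<Sum>v\<in>B. of_bool (supp e = {v, v})))"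
  proof -
    have "(\<Sum>e\<in>X. (\<Sum>u\<in>B. \<Sum>v\<in>B. of_bool (supp e = {u, v})) + (\<Sum>v\<in>B. of_bool (supp e = {v, v}))) = (\<Sum>e\<in>X. (2 :: nat))"
      by (rule sum.cong[OF refl two])
    then show ?thesis by (simp only: sum_constant mult.commute of_nat_id)
  qed
  also have "\<dots> = (\<Sum>e\<in>X. \<Sum>u\<in>B. \<Sum>v\<in>B. of_bool (supp e = {u, v}))
      + (\<Sum>e\<in>X. \<Sum>v\<in>B. of_bool (supp e = {v, v}))"
    by (rule sum.distrib)
  also have "(\<Sum>e\<in>X. \<Sum>u\<in>B. \<Sum>v\<in>B. of_bool (supp e = {u, v})) = (\<Sum>u\<in>B. \<Sum>v\<in>B. card (edges u v))"
    by (subst sum.swap, rule sum.cong[OF refl], subst sum.swap) (simp only: card_edges)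
  also have "(\<Sum>e\<in>X. \<Sum>v\<in>B. of_bool (supp e = {v, v})) = (\<Sum>v\<in>B. card (edges v v))"
    by (subst sum.swap) (simp only: card_edges)
  finally show ?thesis .
qed

end

section \<open>The bound on the number of elements\<close>

lemma double_choose_two: "2 * (n choose 2) = n * (n - 1)"
  by (cases n) (simp_all add: choose_two)

text \<open>\<open>k \<ge> 1\<close> guarantees that a pair with positive surplus has at least two
  edges, as the contractions require. Summed over ordered pairs, the allowance \<open>k\<close> per
  pair gives the binomial term, and loops with surplus give at most \<open>card B\<close>.\<close>

lemma (in short_lines) card_X_le:
  assumes k: "k \<ge> 1"
  shows "card X \<le> k * (card B choose 2) + card B"
proof -
  define j where "j v = card (edges v v)" for v
  \<comment> \<open>Truncated subtraction gives light pairs weight 0. The value 0 outside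
    \<open>B\<close> lets positivity alone yield membership in \<open>B\<close>.\<close>
  define ex where "ex u v = (if u = v \<or> u \<notin> B \<or> v \<notin> B then 0 else card (edges u v) - k)" for u v
  have exD: "u \<in> B \<and> v \<in> B \<and> u \<noteq> v \<and> card (edges u v) = k + ex u v \<and> card (edges u v) \<ge> 2"
    if "ex u v > 0" for u v
    using that k by (auto simp: ex_def split: if_splits)
  have jD: "edges v v \<noteq> {}" if "j v > 0" for v
    using that by (auto simp: j_def)
  have "2 * (\<Sum>v\<in>B. j v) + (\<Sum>u\<in>B. \<Sum>v\<in>B. ex u v) \<le> 2 * card B"
  proof (rule heavy_graph_weight[OF finite_B])
    show "ex u v = ex v u" for u v
      using edges_commute[of u v] by (auto simp: ex_def)
    show "ex u u = 0" for u by (simp add: ex_def)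
    show "j v \<le> 1" for v unfolding j_def by (rule card_joints_le)
    show "ex u v + j u + j v \<le> 2" if "ex u v > 0" for u v
      using card_edges_joints[of u v] exD[OF that] by (simp add: j_def)
    show "ex v w \<le> 1" if "distinct [u, v, w]" "ex u v > 0" "ex v w > 0" for u v w
      using card_edges_adjacent[of u v w] exD[OF that(2)] exD[OF that(3)] that(1) by simp
    show False if "distinct [a, u, v, b]" "ex a u > 0" "ex u v > 0" "ex v b > 0" for a u v b
      using no_heavy_path[of a u v b] exD[OF that(2)] exD[OF that(3)] exD[OF that(4)] that by simp
    show False if "distinct [u, v, w]" "ex u v > 0" "ex u w > 0" "j v > 0" "j w > 0" for u v w
    proof -
      have "edges u v \<noteq> {}" using exD[OF that(2)] by auto
      then show False
        using no_joints_at_heavy_leaves[OF that(1) _ jD[OF that(4)] jD[OF that(5)]] exD[OF that(3)] that(3)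
        by simp
    qed
    show "j u = 0" if "distinct [u, v, w]" "ex u v > 0" "ex u w > 0" "ex v w > 0" for u v w
    proof (rule ccontr)
      assume "j u \<noteq> 0"
      then have "edges u u \<noteq> {}" using jD by simp
      then show False
        using no_joint_at_heavy_triangle[OF that(1)] exD[OF that(2)] exD[OF that(4)] that(2) by simp
    qed
  qed simp
  moreover have "2 * card X \<le> 2 * (\<Sum>v\<in>B. j v) + (\<Sum>u\<in>B. \<Sum>v\<in>B. ex u v) + k * (card B * (card B - 1))"
  proof -
    have "card (edges u v) \<le> (if u = v then j u else 0) + ((if u = v then 0 else k) + ex u v)"
      if "u \<in> B" "v \<in> B" for u v
      using that by (auto simp: ex_def j_def)
    then have "(\<Sum>u\<in>B. \<Sum>v\<in>B. card (edges u v)) \<le>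
        (\<Sum>u\<in>B. \<Sum>v\<in>B. (if u = v then j u else 0) + ((if u = v then 0 else k) + ex u v))"
      by (intro sum_mono) auto
    also have "\<dots> = (\<Sum>u\<in>B. j u) + ((\<Sum>u\<in>B. \<Sum>v\<in>B. if u = v then 0 else k) + (\<Sum>u\<in>B. \<Sum>v\<in>B. ex u v))"
      using finite_B by (simp add: sum.distrib)
    also have "(\<Sum>u\<in>B. \<Sum>v\<in>B. if u = v then 0 else k) = (\<Sum>u\<in>B. (card B - 1) * k)"
    proof (rule sum.cong[OF refl])
      fix u assume u: "u \<in> B"
      have "(\<Sum>v\<in>B. if u = v then 0 else k) = (\<Sum>v\<in>B - {u}. k)"
        by (intro sum.mono_neutral_cong_right) (use finite_B in auto)
      then show "(\<Sum>v\<in>B. if u = v then 0 else k) = (card B - 1) * k"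
        using u finite_B by simp
    qed
    also have "\<dots> = k * (card B * (card B - 1))" by simp
    finally show ?thesis
      unfolding double_card_X j_def by simp
  qed
  ultimately have "2 * card X \<le> 2 * (k * (card B choose 2) + card B)"
    unfolding double_choose_two[symmetric] by simp
  then show ?thesis by simp
qed

text \<open>A dependent set of least size is a circuit, with at least three elements by simplicity.
  Contracting all but three of them leaves a triangle: the whole is dependent, but dropping any one
  element makes it independent.\<close>

lemma (in matroid) simple_no_triangle_minor_free:
  assumes simple: "simple_matroid M" and no: "\<not> has_minor M (uniform_matroid 2 3)"
  shows "ground M \<in> indeps M"
proof (rule ccontr)
  assume dep: "ground M \<notin> indeps M"
  have "\<exists>D. (D \<subseteq> ground M \<and> D \<notin> indeps M) \<and>
      (\<forall>D'. D' \<subseteq> ground M \<and> D' \<notin> indeps M \<longrightarrow> card D \<le> card D')"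
    by (rule ex_has_least_nat[of _ "ground M"]) (use dep in simp)
  then obtain D where D: "D \<subseteq> ground M" "D \<notin> indeps M"
    and min: "\<And>D'. D' \<subseteq> ground M \<Longrightarrow> D' \<notin> indeps M \<Longrightarrow> card D \<le> card D'"
    by (elim exE conjE) simp
  have fin: "finite D" using D(1) finite_ground by (rule finite_subset)
  have rank: "rank_of M D' = card D'" if "D' \<subset> D" for D'
  proof -
    have "card D' < card D" using that fin by (rule psubset_card_mono[rotated])
    then have "D' \<in> indeps M" using min[of D'] that D(1) by fastforce
    then show ?thesis by (rule rank_indep)
  qed
  have "3 \<le> card D"
  proof (rule ccontr)
    assume "\<not> 3 \<le> card D"
    then consider "card D = 0" | "card D = 1" | "card D = 2" by linarith
    then show False
    proof cases
      case 1
      then show False using D fin indep_empty by simp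
    next
      case 2
      then obtain e where "D = {e}" by (rule card_1_singletonE)
      then show False using D simple by (auto simp: simple_matroid_def loop_def)
    next
      case 3
      then obtain e f where "D = {e, f}" "e \<noteq> f" by (meson card_2_iff)
      then show False using D simple
        by (auto simp: simple_matroid_def parallel_pair_def)
    qed
  qed
  then obtain Z where Z: "Z \<subseteq> D" "card Z = 3"
    using obtain_subset_with_card_n[of 3 D] by auto
  have C: "rank_of M (D - Z) + 3 = card D"
  proof -
    have "Z \<noteq> {}" using Z(2) by auto
    then have "D - Z \<subset> D" using Z(1) by blast
    then show ?thesis
      using rank[of "D - Z"] Z fin \<open>3 \<le> card D\<close>
      by (simp add: card_Diff_subset finite_subset)
  qed
  have "rank_of M D < card D"
    using D(2) indep_iff_rank[OF fin] rank_le_card[OF fin] by linarith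
  then have "rank_of M (Z \<union> (D - Z)) \<le> rank_of M (D - Z) + 2"
    using C Z(1) by (simp add: Un_absorb1)
  moreover have "rank_of M (D - Z) + 2 \<le> rank_of M ({x, y} \<union> (D - Z))"
    if "x \<in> Z" "y \<in> Z" "x \<noteq> y" for x y
  proof -
    have "card (Z - {x, y}) = 1"
      using that Z by (subst card_Diff_subset) auto
    then obtain z where z: "Z - {x, y} = {z}" by (rule card_1_singletonE)
    then have eq: "{x, y} \<union> (D - Z) = D - {z}" "z \<in> D" using that Z(1) by auto
    then have "rank_of M ({x, y} \<union> (D - Z)) = card D - 1"
      using rank[of "D - {z}"] fin by (auto simp: psubset_eq)
    then show ?thesis using C by simp
  qed
  ultimately have "has_minor M (uniform_matroid 2 (card Z))"
    using D(1) Z by (intro has_line_minorI[of "D - Z"]) auto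
  then show False using no Z(2) by simp
qed

lemma card_ground_frame_matroid_le:
  assumes "l \<ge> 1" "frame_matroid M" "simple_matroid M"
    and no: "\<not> has_minor M (uniform_matroid 2 (l + 2))"
  shows "card (ground M) \<le> (l - 1) * (matroid_rank M choose 2) + matroid_rank M"
proof (cases "l = 1")
  case True
  interpret matroid M using assms(3) by (simp add: simple_matroid_def)
  have "ground M \<in> indeps M"
    using simple_no_triangle_minor_free[OF assms(3)] no True by (simp add: numeral_3_eq_3)
  then show ?thesis
    by (simp add: matroid_rank_def rank_indep True)
next
  case False
  obtain M0 B0 X where M0: "framed_by M0 B0" "X \<subseteq> ground M0" "M = restriction M0 X"
    using assms(2) unfolding frame_matroid_def by blast
  interpret M0: matroid M0 using M0(1) by (simp add: framed_by_def)
  obtain M' B where M': "framed_by M' B" "X \<subseteq> ground M'" "restriction M' X = M"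
    "card B = rank_of M0 X"
    using M0.frame_restriction_spanning[OF M0(1,2)] M0(3) by auto
  interpret M': matroid M' using M'(1) by (simp add: framed_by_def)
  have gr: "ground M = X"
    using M0(2,3) by (auto simp: restriction_def)
  have r: "matroid_rank M = card B"
    unfolding matroid_rank_def gr using M'(4) M0.rank_restriction[of X X] M0(3) by simp
  interpret short_lines M' B X "l - 1"
  proof unfold_locales
    \<comment> \<open>Here \<open>l \<ge> 1\<close> is what makes \<open>l - 1 + 3\<close> equal to
      \<open>l + 2\<close>.\<close>
    show "\<not> has_minor (restriction M' X) (uniform_matroid 2 (l - 1 + 3))"
      using no assms(1) M'(3) by (simp add: numeral_3_eq_3 numeral_2_eq_2)
  qed (use M' assms(3) in \<open>auto simp: framed_by_def\<close>)
  show ?thesis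
    unfolding gr r using card_X_le False assms(1) by simp
qed

section \<open>Complex representable matroids\<close>

text \<open>Vectors are complex sequences with pointwise addition, so a single space serves every
  rank.\<close>

definition cscale :: "complex \<Rightarrow> (nat \<Rightarrow> complex) \<Rightarrow> nat \<Rightarrow> complex" where
  "cscale c f = (\<lambda>i. c * f i)"

lemma cscale_apply: "cscale c f i = c * f i"
  by (simp add: cscale_def)

global_interpretation cvec: vector_space cscale
  by standard (auto simp: cscale_def fun_eq_iff algebra_simps)

text \<open>The labels \<open>E\<close> can come from any type, as the class lives on an arbitrary
  infinite one. Independence is that of the image set, so it agrees with independence of the family
  only where \<open>\<nu>\<close> is injective.\<close>

definition vec_matroid :: "('c \<Rightarrow> nat \<Rightarrow> complex) \<Rightarrow> 'c set \<Rightarrow> 'c set_system" where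
  "vec_matroid \<nu> E = \<lparr>ground = E, indeps = {I. I \<subseteq> E \<and> \<not> cvec.dependent (\<nu> ` I)}\<rparr>"

lemma insert_indep_vec_matroid:
  "I \<in> indeps (vec_matroid \<nu> E) \<Longrightarrow> e \<in> E \<Longrightarrow> \<nu> e \<notin> cvec.span (\<nu> ` I) \<Longrightarrow>
    insert e I \<in> indeps (vec_matroid \<nu> E)"
  by (auto simp: vec_matroid_def cvec.independent_insertI)

lemma card_le_of_indep_vec_matroid:
  assumes inj: "inj_on \<nu> E" and J: "J \<in> indeps (vec_matroid \<nu> E)"
    and A: "finite A" "\<nu> ` J \<subseteq> cvec.span (\<nu> ` A)"
  shows "card J \<le> card A"
proof -
  have "\<not> cvec.dependent (\<nu> ` J)" "inj_on \<nu> J"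
    using J inj by (auto simp: vec_matroid_def intro: inj_on_subset)
  then have "card J = card (\<nu> ` J)" by (simp add: card_image)
  also have "\<dots> \<le> card (\<nu> ` A)"
    using cvec.independent_span_bound[of "\<nu> ` A" "\<nu> ` J"] \<open>\<not> cvec.dependent (\<nu> ` J)\<close> A by simp
  also have "\<dots> \<le> card A" by (rule card_image_le[OF A(1)])
  finally show ?thesis .
qed

lemma matroid_vec_matroid:
  assumes "finite E" and inj: "inj_on \<nu> E"
  shows "matroid (vec_matroid \<nu> E)"
proof
  fix X Y
  assume X: "X \<in> indeps (vec_matroid \<nu> E)" and Y: "Y \<in> indeps (vec_matroid \<nu> E)"
    and lt: "card X < card Y"
  have XE: "X \<subseteq> E" "Y \<subseteq> E" using X Y by (auto simp: vec_matroid_def)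
  have "\<not> \<nu> ` Y \<subseteq> cvec.span (\<nu> ` X)"
    using card_le_of_indep_vec_matroid[OF inj Y] lt finite_subset[OF XE(1) assms(1)]
    by fastforce
  then obtain y where y: "y \<in> Y" "\<nu> y \<notin> cvec.span (\<nu> ` X)" by blast
  then have "y \<notin> X" using cvec.span_base by blast
  then show "\<exists>y\<in>Y - X. insert y X \<in> indeps (vec_matroid \<nu> E)"
    using insert_indep_vec_matroid[OF X _ y(2)] y XE by blast
next
  fix X Y assume "X \<in> indeps (vec_matroid \<nu> E)" "Y \<subseteq> X"
  then show "Y \<in> indeps (vec_matroid \<nu> E)"
    using cvec.independent_mono[of "\<nu> ` X" "\<nu> ` Y"] by (auto simp: vec_matroid_def)
qed (use assms cvec.independent_empty in \<open>auto simp: vec_matroid_def\<close>)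

text \<open>Closure is defined by rank; by maximality a largest independent subset of
  \<open>A\<close> has the same linear span as \<open>A\<close>. Hence closures can be computed in
  the vector space.\<close>

lemma in_closure_vec_matroid_iff:
  assumes E: "finite E" and inj: "inj_on \<nu> E" and "A \<subseteq> E" "e \<in> E"
  shows "e \<in> closure_of_set (vec_matroid \<nu> E) A \<longleftrightarrow> \<nu> e \<in> cvec.span (\<nu> ` A)"
proof -
  interpret matroid "vec_matroid \<nu> E"
    by (rule matroid_vec_matroid[OF E inj])
  let ?M = "vec_matroid \<nu> E"
  obtain J where J: "J \<in> indeps ?M" "J \<subseteq> A" "card J = rank_of ?M A"
    using rank_attained by blast
  have finJ: "finite J" using J indep_finite by blast
  have "\<nu> ` A \<subseteq> cvec.span (\<nu> ` J)"
  proof (rule ccontr)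
    assume "\<not> ?thesis"
    then obtain a where a: "a \<in> A" "\<nu> a \<notin> cvec.span (\<nu> ` J)" by blast
    then have "a \<notin> J" using cvec.span_base by blast
    have "insert a J \<in> indeps ?M"
      using insert_indep_vec_matroid[OF J(1) _ a(2)] a assms by blast
    from card_le_rank[OF this, of A] show False
      using J a \<open>a \<notin> J\<close> finJ by simp
  qed
  from cvec.span_minimal[OF this cvec.subspace_span] have sp: "cvec.span (\<nu> ` A) = cvec.span (\<nu> ` J)"
    using cvec.span_mono[OF image_mono[OF J(2)], of \<nu>] by blast
  show ?thesis
  proof
    assume "e \<in> closure_of_set ?M A"
    then have eq: "rank_of ?M (insert e A) = rank_of ?M A"
      by (simp add: closure_of_set_def)
    show "\<nu> e \<in> cvec.span (\<nu> ` A)"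
    proof (rule ccontr)
      assume n: "\<nu> e \<notin> cvec.span (\<nu> ` A)"
      then have "e \<notin> J" using J(2) cvec.span_base by blast
      have "insert e J \<in> indeps ?M"
        using insert_indep_vec_matroid[OF J(1) assms(4)] n sp by simp
      from card_le_rank[OF this, of "insert e A"] show False
        using J eq \<open>e \<notin> J\<close> finJ by auto
    qed
  next
    assume e: "\<nu> e \<in> cvec.span (\<nu> ` A)"
    obtain K where K: "K \<in> indeps ?M" "K \<subseteq> insert e A" "card K = rank_of ?M (insert e A)"
      using rank_attained by blast
    have "\<nu> ` A \<subseteq> cvec.span (\<nu> ` A)" by (rule cvec.span_superset)
    then have "\<nu> ` K \<subseteq> cvec.span (\<nu> ` J)"
      using K(2) e unfolding sp by blast
    then have "card K \<le> card J"
      by (rule card_le_of_indep_vec_matroid[OF inj K(1) finJ])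
    then have "rank_of ?M (insert e A) = rank_of ?M A"
      using K J rank_mono[OF subset_insertI[of A e]] by simp
    then show "e \<in> closure_of_set ?M A"
      using assms(4) by (simp add: closure_of_set_def vec_matroid_def)
  qed
qed

section \<open>Dowling geometries\<close>

definition unit_vec :: "nat \<Rightarrow> nat \<Rightarrow> complex" where
  "unit_vec i = (\<lambda>j. if j = i then 1 else 0)"

lemma unit_vec_apply: "unit_vec i j = (if j = i then 1 else 0)"
  by (simp add: unit_vec_def)

lemma inj_unit_vec: "inj unit_vec"
  by (rule injI) (metis unit_vec_apply zero_neq_one)

text \<open>The value at 0 is the whole plane, so counting statements require
  \<open>k > 0\<close>.\<close>

definition roots :: "nat \<Rightarrow> complex set" where
  "roots k = {z. z ^ k = 1}"

lemma divide_mem_roots: "z \<in> roots k \<Longrightarrow> w \<in> roots k \<Longrightarrow> z / w \<in> roots k"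
  by (simp add: roots_def power_divide)

lemma mult_mem_roots: "z \<in> roots k \<Longrightarrow> w \<in> roots k \<Longrightarrow> z * w \<in> roots k"
  by (simp add: roots_def power_mult_distrib)

lemma one_mem_roots: "1 \<in> roots k"
  by (simp add: roots_def)

lemma zero_notin_roots: "k > 0 \<Longrightarrow> 0 \<notin> roots k"
  by (simp add: roots_def zero_power)

lemma card_roots: "k > 0 \<Longrightarrow> card (roots k) = k"
  by (simp add: roots_def card_roots_unity_eq)

lemma finite_roots: "k > 0 \<Longrightarrow> finite (roots k)"
  using card_roots card_gt_0_iff by metis

definition frame_vec :: "nat \<Rightarrow> (nat \<Rightarrow> complex) \<Rightarrow> bool" where
  "frame_vec k w \<longleftrightarrow> (\<exists>g \<in> insert 0 (roots k). \<exists>h \<in> insert 0 (roots k). \<exists>r s.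
    w = cscale g (unit_vec r) - cscale h (unit_vec s))"

text \<open>Modulo \<open>w\<close>, a unit vector \<open>unit_vec r\<close> becomes a root multiple
  of another one, or zero. When both terms of \<open>w\<close> sit at the same index,
  \<open>w r\<close> need not be a root, but then the remainder vanishes.\<close>

lemma frame_vec_pivot:
  assumes "k > 0" "frame_vec k w" "w \<noteq> 0"
  obtains r g s where "w r \<noteq> 0" "g \<in> insert 0 (roots k)"
    "unit_vec r - cscale (1 / w r) w = cscale g (unit_vec s)"
proof -
  obtain g h r s where g: "g \<in> insert 0 (roots k)" and h: "h \<in> insert 0 (roots k)"
    and w: "w = cscale g (unit_vec r) - cscale h (unit_vec s)"
    using assms(2) unfolding frame_vec_def by blast
  show ?thesis
  proof (cases "r = s")
    case True
    then have w': "w = cscale (g - h) (unit_vec r)"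
      using w by (auto simp: fun_eq_iff cscale_apply algebra_simps)
    then have "g - h \<noteq> 0" using assms(3) by (auto simp: fun_eq_iff cscale_apply)
    then show ?thesis
      using w' by (intro that[of r 0 r]) (auto simp: fun_eq_iff cscale_apply unit_vec_apply)
  next
    case rs: False
    show ?thesis
    proof (cases "g = 0")
      case True
      then have "h \<noteq> 0" using w assms(3) by (auto simp: fun_eq_iff cscale_apply)
      then show ?thesis
        using w True by (intro that[of s 0 r]) (auto simp: fun_eq_iff cscale_apply unit_vec_apply)
    next
      case False
      have "h / g \<in> insert 0 (roots k)"
        using g h False divide_mem_roots by auto
      then show ?thesis
        using w False rs by (intro that[of r "h / g" s]) (auto simp: fun_eq_iff cscale_apply unit_vec_apply)
    qed
  qed
qed

text \<open>Gaussian elimination, one vector of \<open>C\<close> at a time. The invariant is that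
  unit vectors go to zero or to root multiples of unit vectors. The last two conclusions make the
  kernel exactly the span of \<open>C\<close>, so \<open>\<phi>\<close> represents contraction of
  \<open>C\<close>.\<close>

lemma projection_along_frame_vecs:
  assumes "k > 0" "finite C" "\<And>c. c \<in> C \<Longrightarrow> frame_vec k c"
  obtains \<phi> where "\<And>x y. \<phi> (x + y) = \<phi> x + \<phi> y" "\<And>a x. \<phi> (cscale a x) = cscale a (\<phi> x)"
    "\<And>i. \<exists>g \<in> insert 0 (roots k). \<exists>s. \<phi> (unit_vec i) = cscale g (unit_vec s)"
    "\<And>c. c \<in> C \<Longrightarrow> \<phi> c = 0" "\<And>v. v - \<phi> v \<in> cvec.span C"
proof -
  define P where "P C \<phi> \<longleftrightarrow> (\<forall>x y. \<phi> (x + y) = \<phi> x + \<phi> y)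
    \<and> (\<forall>a x. \<phi> (cscale a x) = cscale a (\<phi> x))
    \<and> (\<forall>i. \<exists>g \<in> insert 0 (roots k). \<exists>s. \<phi> (unit_vec i) = cscale g (unit_vec s))
    \<and> (\<forall>c\<in>C. \<phi> c = 0) \<and> (\<forall>v. v - \<phi> v \<in> cvec.span C)" for C \<phi>
  have "\<exists>\<phi>. P C \<phi>"
    using assms(2,3)
  proof (induction C rule: finite_induct)
    case empty
    have "unit_vec i = cscale 1 (unit_vec i)" for i
      by (auto simp: fun_eq_iff cscale_apply)
    then have "\<exists>g\<in>insert 0 (roots k). \<exists>s. unit_vec i = cscale g (unit_vec s)" for i
      using one_mem_roots by blast
    then show ?case
      unfolding P_def by (intro exI[of _ "\<lambda>x. x"]) (simp add: cvec.span_zero)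
  next
    case (insert d C)
    then obtain \<phi> where \<phi>: "P C \<phi>" by blast
    then have add: "\<And>x y. \<phi> (x + y) = \<phi> x + \<phi> y"
      and scale: "\<And>a x. \<phi> (cscale a x) = cscale a (\<phi> x)"
      and unit: "\<And>i. \<exists>g \<in> insert 0 (roots k). \<exists>s. \<phi> (unit_vec i) = cscale g (unit_vec s)"
      and zero: "\<And>c. c \<in> C \<Longrightarrow> \<phi> c = 0" and proj: "\<And>v. v - \<phi> v \<in> cvec.span C"
      unfolding P_def by blast+
    have diff: "\<phi> (x - y) = \<phi> x - \<phi> y" for x y
      using add[of "x - y" y] by (simp add: algebra_simps)
    have span_sub: "v \<in> cvec.span (insert d C)" if "v \<in> cvec.span C" for v
      using that cvec.span_mono[of C "insert d C"] by blast
    show ?case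
    proof (cases "\<phi> d = 0")
      case True
      then show ?thesis
        using \<phi> span_sub unfolding P_def by (intro exI[of _ \<phi>]) simp
    next
      case False
      define w where "w = \<phi> d"
      obtain g h r s where "g \<in> insert 0 (roots k)" "h \<in> insert 0 (roots k)"
        "d = cscale g (unit_vec r) - cscale h (unit_vec s)"
        using insert.prems[of d] unfolding frame_vec_def by blast
      moreover obtain g' r' where "g' \<in> insert 0 (roots k)" "\<phi> (unit_vec r) = cscale g' (unit_vec r')"
        using unit by blast
      moreover obtain h' s' where "h' \<in> insert 0 (roots k)" "\<phi> (unit_vec s) = cscale h' (unit_vec s')"
        using unit by blast
      ultimately have gh: "g' \<in> insert 0 (roots k)" "h' \<in> insert 0 (roots k)"
        "w = cscale g (cscale g' (unit_vec r')) - cscale h (cscale h' (unit_vec s'))"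
        "g \<in> insert 0 (roots k)" "h \<in> insert 0 (roots k)"
        unfolding w_def by (simp_all add: diff scale)
      have "g * g' \<in> insert 0 (roots k)" "h * h' \<in> insert 0 (roots k)"
        using gh mult_mem_roots by auto
      moreover have "w = cscale (g * g') (unit_vec r') - cscale (h * h') (unit_vec s')"
        using gh(3) by simp
      ultimately have "frame_vec k w"
        unfolding frame_vec_def by blast
      then obtain p c t where p: "w p \<noteq> 0" "c \<in> insert 0 (roots k)"
        "unit_vec p - cscale (1 / w p) w = cscale c (unit_vec t)"
        using frame_vec_pivot[OF assms(1), of w] False w_def by blast
      \<comment> \<open>Elimination of coordinate \<open>p\<close> along \<open>w\<close>. The other
        unit vectors vanish at \<open>p\<close> and stay fixed; \<open>unit_vec p\<close> is handled
        by the choice of pivot.\<close>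
      define \<psi> where "\<psi> v = v - cscale (v p / w p) w" for v
      have \<psi>_add: "\<psi> (x + y) = \<psi> x + \<psi> y" for x y
        by (auto simp: \<psi>_def fun_eq_iff cscale_apply add_divide_distrib algebra_simps)
      have \<psi>_scale: "\<psi> (cscale a x) = cscale a (\<psi> x)" for a x
        by (auto simp: \<psi>_def fun_eq_iff cscale_apply algebra_simps)
      have \<psi>_unit: "\<exists>g \<in> insert 0 (roots k). \<exists>s. \<psi> (unit_vec i) = cscale g (unit_vec s)" for i
      proof (cases "i = p")
        case True
        then show ?thesis using p by (auto simp: \<psi>_def unit_vec_apply)
      next
        case False
        then have "\<psi> (unit_vec i) = cscale 1 (unit_vec i)"
          by (auto simp: \<psi>_def fun_eq_iff cscale_apply unit_vec_apply)
        then show ?thesis using one_mem_roots by blast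
      qed
      have \<psi>_zero: "\<psi> 0 = 0" "\<psi> w = 0"
        using p by (auto simp: \<psi>_def fun_eq_iff cscale_apply)
      have wspan: "w \<in> cvec.span (insert d C)"
      proof -
        have "d - (d - w) \<in> cvec.span (insert d C)"
          unfolding w_def
          by (rule cvec.span_diff[OF cvec.span_base[OF insertI1] span_sub[OF proj]])
        then show ?thesis by simp
      qed
      show ?thesis
        unfolding P_def
      proof (intro exI[of _ "\<lambda>v. \<psi> (\<phi> v)"] conjI allI ballI)
        fix i
        obtain g s where g: "g \<in> insert 0 (roots k)" "\<phi> (unit_vec i) = cscale g (unit_vec s)"
          using unit by blast
        obtain g' s' where g': "g' \<in> insert 0 (roots k)" "\<psi> (unit_vec s) = cscale g' (unit_vec s')"
          using \<psi>_unit by blast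
        have "\<psi> (\<phi> (unit_vec i)) = cscale (g * g') (unit_vec s')"
          using g g' by (simp add: \<psi>_scale)
        moreover have "g * g' \<in> insert 0 (roots k)"
          using g g' mult_mem_roots by auto
        ultimately show "\<exists>g \<in> insert 0 (roots k). \<exists>s. \<psi> (\<phi> (unit_vec i)) = cscale g (unit_vec s)"
          by blast
      next
        fix v
        have "v - \<psi> (\<phi> v) = (v - \<phi> v) + cscale (\<phi> v p / w p) w"
          by (simp add: \<psi>_def)
        then show "v - \<psi> (\<phi> v) \<in> cvec.span (insert d C)"
          using cvec.span_add[OF span_sub[OF proj] cvec.span_scale[OF wspan]] by metis
      qed (use zero \<psi>_zero w_def in \<open>auto simp: add scale \<psi>_add \<psi>_scale\<close>)
    qed
  qed
  then show ?thesis using that unfolding P_def by blast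
qed

section \<open>Planes of frame vectors and line minors\<close>

lemma in_span_pairD:
  assumes "z \<in> cvec.span {x, y}"
  obtains a b where "z = cscale a x + cscale b y"
proof -
  obtain a where "z - cscale a x \<in> cvec.span {y}"
    using assms by (auto simp: cvec.span_breakdown_eq)
  then obtain b where "z - cscale a x = cscale b y"
    by (auto simp: cvec.span_singleton)
  then have "z = cscale a x + cscale b y" by (simp add: algebra_simps)
  then show ?thesis by (rule that)
qed

text \<open>Two coordinates on which the plane projects injectively are enough: a vector of the plane
  with both of these coordinates nonzero is supported on them.\<close>

lemma card_frame_vecs_in_plane:
  assumes k: "k > 0" and fv: "\<And>z. z \<in> Z \<Longrightarrow> frame_vec k z"
    and xy: "x \<in> Z" "y \<in> Z" "x \<noteq> y"
    and plane: "\<And>z. z \<in> Z \<Longrightarrow> z \<in> cvec.span {x, y}"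
    and nonpar: "\<And>z w. z \<in> Z \<Longrightarrow> w \<in> Z \<Longrightarrow> z \<noteq> w \<Longrightarrow> z \<notin> cvec.span {w}"
  shows "card Z \<le> k + 2"
proof -
  have nz: "z \<noteq> 0" if "z \<in> Z" for z
    using nonpar[of z x] nonpar[of z y] xy that cvec.span_zero by metis
  obtain r where r: "x r \<noteq> 0"
    using nz[OF xy(1)] by (auto simp: fun_eq_iff cscale_apply)
  \<comment> \<open>This combination is zero at \<open>r\<close>; a nonzero coordinate of it
    supplies \<open>s\<close> with a nonvanishing 2 by 2 determinant \<open>D\<close>.\<close>
  have "y - cscale (y r / x r) x \<noteq> 0"
  proof
    assume "y - cscale (y r / x r) x = 0"
    then have "y = cscale (y r / x r) x" by simp
    then have "y \<in> cvec.span {x}"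
      by (metis cvec.span_base cvec.span_scale singletonI)
    then show False using nonpar[OF xy(2,1)] xy(3) by auto
  qed
  then obtain s where s: "y s - y r / x r * x s \<noteq> 0"
    by (auto simp: fun_eq_iff cscale_apply)
  define D where "D = x r * y s - x s * y r"
  have D: "D \<noteq> 0"
    using s r by (simp add: D_def field_simps)
  then have rs: "r \<noteq> s" by (auto simp: D_def)
  have det: "u = 0" if uspan: "u \<in> cvec.span {x, y}" and u0: "u r = 0" "u s = 0" for u
  proof -
    obtain a b where u: "u = cscale a x + cscale b y"
      by (rule in_span_pairD[OF uspan])
    then have e: "a * x r + b * y r = 0" "a * x s + b * y s = 0"
      using u0 by (simp_all add: cscale_apply)
    have "a * D = y s * (a * x r + b * y r) - y r * (a * x s + b * y s)"
      "b * D = x r * (a * x s + b * y s) - x s * (a * x r + b * y r)"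
      unfolding D_def by (simp_all add: algebra_simps)
    then have "a * D = 0" "b * D = 0" unfolding e by simp_all
    then have "a = 0" "b = 0" using D by simp_all
    then show ?thesis using u by (auto simp: fun_eq_iff cscale_apply)
  qed
  \<comment> \<open>The slope in coordinates \<open>r\<close> and \<open>s\<close>, with
    \<open>None\<close> as the point at infinity.\<close>
  define \<rho> where "\<rho> z = (if z r = 0 then None else Some (z s / z r))" for z :: "nat \<Rightarrow> complex"
  have "inj_on \<rho> Z"
  proof (rule inj_onI, rule ccontr)
    fix z w assume z: "z \<in> Z" and w: "w \<in> Z" and eq: "\<rho> z = \<rho> w" and "z \<noteq> w"
    have comb: False if "a \<noteq> 0" "a * z r = b * w r" "a * z s = b * w s" for a b
    proof -
      have "cscale a z - cscale b w = 0"
      proof (rule det)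
        show "cscale a z - cscale b w \<in> cvec.span {x, y}"
          by (rule cvec.span_diff[OF cvec.span_scale[OF plane[OF z]] cvec.span_scale[OF plane[OF w]]])
      qed (use that in \<open>simp_all add: cscale_apply\<close>)
      then have "a * z i = b * w i" for i by (simp add: fun_eq_iff cscale_apply)
      then have "z = cscale (b / a) w"
        using that(1) by (auto simp: fun_eq_iff cscale_apply field_simps)
      then have "z \<in> cvec.span {w}"
        by (metis cvec.span_base cvec.span_scale singletonI)
      then show False using nonpar z w \<open>z \<noteq> w\<close> by blast
    qed
    show False
    proof (cases "z r = 0")
      case True
      then have "w r = 0" using eq by (auto simp: \<rho>_def split: if_splits)
      then have "w s \<noteq> 0" using det plane w nz by blast
      then show False
        using comb[of "w s" "z s"] True \<open>w r = 0\<close> by simp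
    next
      case False
      then have "w r \<noteq> 0" "z s / z r = w s / w r"
        using eq by (auto simp: \<rho>_def split: if_splits)
      then show False
        using comb[of "w r" "z r"] False by (simp add: field_simps)
    qed
  qed
  \<comment> \<open>A vector nonzero at both \<open>r\<close> and \<open>s\<close> has its two terms
    there, in one order or the other. Its slope is minus a quotient of roots, which leaves
    \<open>k\<close> values besides 0 and infinity.\<close>
  moreover have "\<rho> ` Z \<subseteq> {None, Some 0} \<union> Some ` uminus ` roots k"
  proof
    fix v assume "v \<in> \<rho> ` Z"
    then obtain z where z: "z \<in> Z" "v = \<rho> z" by blast
    show "v \<in> {None, Some 0} \<union> Some ` uminus ` roots k"
    proof (cases "z r = 0 \<or> z s = 0")
      case False
      obtain g h a b where g: "g \<in> insert 0 (roots k)" and h: "h \<in> insert 0 (roots k)"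
        and zz: "z = cscale g (unit_vec a) - cscale h (unit_vec b)"
        using fv[OF z(1)] unfolding frame_vec_def by blast
      have co: "z i = (if i = a then g else 0) - (if i = b then h else 0)" for i
        by (simp add: zz unit_vec_apply cscale_apply)
      have "r = a \<and> s = b \<or> r = b \<and> s = a"
        using False rs co[of r] co[of s] by (auto split: if_splits)
      then show ?thesis
      proof
        assume "r = a \<and> s = b"
        then have "z r = g" "z s = - h" using co rs by auto
        moreover from this have "h / g \<in> roots k"
          using False g h divide_mem_roots by auto
        ultimately show ?thesis using z False by (auto simp: \<rho>_def)
      next
        assume "r = b \<and> s = a"
        then have "z r = - h" "z s = g" using co rs by auto
        moreover from this have "g / h \<in> roots k"
          using False g h divide_mem_roots by auto
        ultimately show ?thesis using z False by (auto simp: \<rho>_def)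
      qed
    qed (use z in \<open>auto simp: \<rho>_def\<close>)
  qed
  ultimately have "card Z \<le> card ({None, Some 0} \<union> Some ` uminus ` roots k)"
    using finite_roots[OF k] by (intro card_inj_on_le[of \<rho>]) auto
  also have "\<dots> \<le> card {None, Some (0::complex)} + card (Some ` uminus ` roots k)"
    by (rule card_Un_le)
  also have "\<dots> \<le> 2 + k"
  proof -
    have "card (uminus ` roots k) \<le> k"
      using card_image_le[OF finite_roots[OF k], of uminus] card_roots[OF k] by simp
    moreover have "card (Some ` uminus ` roots k) \<le> card (uminus ` roots k)"
      by (intro card_image_le finite_imageI finite_roots k)
    ultimately show ?thesis by (simp add: card_insert_if)
  qed
  finally show ?thesis by simp
qed

text \<open>The projection along \<open>C\<close> sends the points of a line minor to pairwise
  nonparallel frame vectors in one plane, of which there are at most \<open>k + 2\<close>.\<close>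

lemma no_long_line_minor_vec_matroid:
  assumes k: "k > 0" and E: "finite E" "inj_on \<nu> E"
    and fv: "\<And>e. e \<in> E \<Longrightarrow> frame_vec k (\<nu> e)"
  shows "\<not> has_minor (vec_matroid \<nu> E) (uniform_matroid 2 (k + 3))"
proof
  interpret matroid "vec_matroid \<nu> E" by (rule matroid_vec_matroid[OF E])
  assume "has_minor (vec_matroid \<nu> E) (uniform_matroid 2 (k + 3))"
  then obtain C Z where CZ: "C \<subseteq> ground (vec_matroid \<nu> E)" "Z \<subseteq> ground (vec_matroid \<nu> E)"
    and card: "card Z = k + 3"
    and nonpar: "\<And>x y. x \<in> Z \<Longrightarrow> y \<in> Z \<Longrightarrow> x \<noteq> y \<Longrightarrow> x \<notin> cl (insert y C)"
    and line: "\<And>x y z. x \<in> Z \<Longrightarrow> y \<in> Z \<Longrightarrow> z \<in> Z \<Longrightarrow> x \<noteq> y \<Longrightarrow> z \<in> cl (insert x (insert y C))"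
    by (rule has_line_minorD) blast
  have CE: "C \<subseteq> E" and ZE: "Z \<subseteq> E" using CZ by (auto simp: vec_matroid_def)
  obtain \<phi> where add: "\<And>x y. \<phi> (x + y) = \<phi> x + \<phi> y"
    and scale: "\<And>a x. \<phi> (cscale a x) = cscale a (\<phi> x)"
    and unit: "\<And>i. \<exists>g \<in> insert 0 (roots k). \<exists>s. \<phi> (unit_vec i) = cscale g (unit_vec s)"
    and zero: "\<And>c. c \<in> \<nu> ` C \<Longrightarrow> \<phi> c = 0" and proj: "\<And>v. v - \<phi> v \<in> cvec.span (\<nu> ` C)"
    using projection_along_frame_vecs[OF k, of "\<nu> ` C"] fv CE finite_subset[OF CE E(1)]
    by blast
  have diff: "\<phi> (x - y) = \<phi> x - \<phi> y" for x y
    using add[of "x - y" y] by (simp add: algebra_simps)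
  have \<phi>0: "\<phi> 0 = 0" using diff[of 0 0] by simp
  have span0: "\<phi> v = 0" if "v \<in> cvec.span (\<nu> ` C)" for v
  proof -
    have "cvec.subspace {v. \<phi> v = 0}"
      by (rule cvec.subspaceI) (auto simp: add scale \<phi>0)
    then show ?thesis
      using cvec.span_minimal[of "\<nu> ` C" "{v. \<phi> v = 0}"] zero that by blast
  qed
  have par: "\<phi> (\<nu> z) \<notin> cvec.span {\<phi> (\<nu> w)}" if "z \<in> Z" "w \<in> Z" "z \<noteq> w" for z w
  proof
    assume "\<phi> (\<nu> z) \<in> cvec.span {\<phi> (\<nu> w)}"
    then obtain a where "\<phi> (\<nu> z) = cscale a (\<phi> (\<nu> w))"
      by (auto simp: cvec.span_singleton)
    then have "\<phi> (\<nu> z - cscale a (\<nu> w)) = 0" by (simp add: diff scale)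
    then have "\<nu> z - cscale a (\<nu> w) \<in> cvec.span (\<nu> ` C)"
      using proj[of "\<nu> z - cscale a (\<nu> w)"] by simp
    then have "\<nu> z \<in> cvec.span (\<nu> ` insert w C)"
      by (auto simp: cvec.span_breakdown_eq)
    then show False
      using nonpar[OF that] in_closure_vec_matroid_iff[OF E, of "insert w C" z] that CE ZE by auto
  qed
  have inj: "inj_on (\<lambda>z. \<phi> (\<nu> z)) Z"
    using par by (intro inj_onI) (metis cvec.span_base singletonI)
  have frame: "frame_vec k (\<phi> (\<nu> z))" if z: "z \<in> Z" for z
  proof -
    obtain g h r s where g: "g \<in> insert 0 (roots k)" and h: "h \<in> insert 0 (roots k)"
      and w: "\<nu> z = cscale g (unit_vec r) - cscale h (unit_vec s)"
      using fv[OF subsetD[OF ZE z]] unfolding frame_vec_def by blast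
    obtain g' r' where r: "g' \<in> insert 0 (roots k)" "\<phi> (unit_vec r) = cscale g' (unit_vec r')"
      using unit by blast
    obtain h' s' where s: "h' \<in> insert 0 (roots k)" "\<phi> (unit_vec s) = cscale h' (unit_vec s')"
      using unit by blast
    have "\<phi> (\<nu> z) = cscale (g * g') (unit_vec r') - cscale (h * h') (unit_vec s')"
      by (simp add: w diff scale r s)
    moreover have "g * g' \<in> insert 0 (roots k)" "h * h' \<in> insert 0 (roots k)"
      using g h r s mult_mem_roots by auto
    ultimately show ?thesis unfolding frame_vec_def by blast
  qed
  obtain x y where xy: "x \<in> Z" "y \<in> Z" "x \<noteq> y"
  proof -
    obtain T where "T \<subseteq> Z" "card T = 2"
      using obtain_subset_with_card_n[of 2 Z] card by auto
    then show ?thesis using that by (auto simp: card_2_iff)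
  qed
  have plane: "\<phi> (\<nu> z) \<in> cvec.span {\<phi> (\<nu> x), \<phi> (\<nu> y)}" if "z \<in> Z" for z
  proof -
    have "\<nu> z \<in> cvec.span (insert (\<nu> x) (insert (\<nu> y) (\<nu> ` C)))"
      using line[OF xy(1,2) that xy(3)] that xy CE ZE
        in_closure_vec_matroid_iff[OF E, of "insert x (insert y C)" z] by auto
    then obtain a b where "\<nu> z - cscale a (\<nu> x) - cscale b (\<nu> y) \<in> cvec.span (\<nu> ` C)"
      by (auto simp: cvec.span_breakdown_eq)
    from span0[OF this] have "\<phi> (\<nu> z) = cscale a (\<phi> (\<nu> x)) + cscale b (\<phi> (\<nu> y))"
      by (simp add: add diff scale algebra_simps)
    then show ?thesis
      by (auto intro: cvec.span_add cvec.span_scale cvec.span_base)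
  qed
  have "card ((\<lambda>z. \<phi> (\<nu> z)) ` Z) \<le> k + 2"
  proof (rule card_frame_vecs_in_plane[OF k, of _ "\<phi> (\<nu> x)" "\<phi> (\<nu> y)"])
    show "\<phi> (\<nu> x) \<noteq> \<phi> (\<nu> y)"
      using inj xy by (auto dest: inj_onD)
  qed (use frame xy plane par in auto)
  then show False
    using card_image[OF inj] card by simp
qed

text \<open>Only \<open>i < j\<close> is used: for nonzero \<open>g\<close>, exchanging
  \<open>i\<close> and \<open>j\<close> and inverting \<open>g\<close> gives a parallel vector. With
  \<open>G\<close> empty this is a standard basis, that is, a free matroid.\<close>

definition dowling :: "complex set \<Rightarrow> nat \<Rightarrow> (nat \<Rightarrow> complex) set" where
  "dowling G n = unit_vec ` {..<n} \<union>
    (\<lambda>(j, i, g). unit_vec i - cscale g (unit_vec j)) ` (SIGMA j:{..<n}. {..<j} \<times> G)"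

lemma dowling_cases:
  assumes "v \<in> dowling G n"
  obtains (unit) i where "i < n" "v = unit_vec i"
    | (edge) i j g where "i < j" "j < n" "g \<in> G" "v = unit_vec i - cscale g (unit_vec j)"
proof -
  let ?f = "\<lambda>(j, i, g). unit_vec i - cscale g (unit_vec j)"
  consider "v \<in> unit_vec ` {..<n}" | "v \<in> ?f ` (SIGMA j:{..<n}. {..<j} \<times> G)"
    using assms unfolding dowling_def by blast
  then show ?thesis
  proof cases
    case 1
    then obtain i where "i < n" "v = unit_vec i" by blast
    then show ?thesis by (rule unit)
  next
    case 2
    then obtain p where "v = ?f p" "p \<in> (SIGMA j:{..<n}. {..<j} \<times> G)" by (rule imageE)
    then show ?thesis
      by (cases p) (auto intro: edge)
  qed
qed

lemma finite_dowling: "finite G \<Longrightarrow> finite (dowling G n)"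
  by (simp add: dowling_def)

text \<open>\<open>0 \<notin> G\<close> gives an edge vector exactly two nonzero coordinates. Since
  \<open>- g\<close> may equal 1, the order of the indices tells its two ends apart.\<close>

lemma card_dowling:
  assumes "finite G" "0 \<notin> G"
  shows "card (dowling G n) = card G * (n choose 2) + n"
proof -
  let ?S = "SIGMA j:{..<n}. {..<j} \<times> G"
  let ?f = "\<lambda>(j, i, g). unit_vec i - cscale g (unit_vec j)"
  have co: "?f (j, i, g) t = (if t = i then 1 else 0) - (if t = j then g else 0)" for j i g t
    by (simp add: unit_vec_apply cscale_apply)
  have "inj_on ?f ?S"
  proof (rule inj_onI)
    fix p p' assume p: "p \<in> ?S" and p': "p' \<in> ?S" and eq: "?f p = ?f p'"
    obtain j i g where jig: "p = (j, i, g)" "i < j" "g \<in> G" using p by auto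
    obtain j' i' g' where jig': "p' = (j', i', g')" "i' < j'" "g' \<in> G" using p' by auto
    have ne: "g \<noteq> 0" "g' \<noteq> 0" using jig jig' assms(2) by auto
    have e: "(if t = i then 1 else 0) - (if t = j then g else 0) =
        (if t = i' then 1 else 0) - (if t = j' then g' else 0)" for t
      using fun_cong[OF eq, of t] unfolding jig jig' co .
    have "j = j'"
      using e[of i] e[of j] e[of i'] e[of j'] ne jig(2) jig'(2)
      by (auto split: if_splits)
    then show "p = p'"
      using e[of i] e[of j] e[of i'] ne jig jig' by (auto split: if_splits)
  qed
  then have "card (?f ` ?S) = card ?S" by (rule card_image)
  also have "\<dots> = (\<Sum>j<n. j * card G)"
    using assms(1) by (simp add: card_cartesian_product)
  also have "\<dots> = card G * (n choose 2)"
    by (induction n) (simp_all add: numeral_2_eq_2 algebra_simps)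
  finally have 1: "card (?f ` ?S) = card G * (n choose 2)" .
  have 2: "card (unit_vec ` {..<n}) = n"
    using card_image[OF inj_on_subset[OF inj_unit_vec subset_UNIV]] by simp
  have "unit_vec ` {..<n} \<inter> ?f ` ?S = {}"
  proof (rule ccontr)
    assume "\<not> ?thesis"
    then obtain t j i g where p: "unit_vec t = ?f (j, i, g)" "i < j" "g \<in> G" by auto
    have "g \<noteq> 0" using p assms(2) by auto
    have "unit_vec t i = ?f (j, i, g) i" "unit_vec t j = ?f (j, i, g) j"
      using p(1) by simp_all
    then show False
      using p(2) \<open>g \<noteq> 0\<close> unfolding co unit_vec_apply by (auto split: if_splits)
  qed
  then have "card (dowling G n) = card (unit_vec ` {..<n}) + card (?f ` ?S)"
    unfolding dowling_def using assms(1) by (intro card_Un_disjoint) auto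
  then show ?thesis using 1 2 by simp
qed

text \<open>A normal form up to scaling: of two parallel vectors with leading coordinate 1, neither
  can start earlier, so the factor is 1.\<close>

lemma dowling_leading:
  assumes "v \<in> dowling G n"
  obtains i where "v i = 1" "\<And>t. t < i \<Longrightarrow> v t = 0"
  using assms
proof (cases rule: dowling_cases)
  case (unit i)
  then show ?thesis by (intro that[of i]) (simp_all add: unit_vec_apply)
next
  case (edge i j g)
  then show ?thesis by (intro that[of i]) (simp_all add: unit_vec_apply cscale_apply)
qed

lemma dowling_nonzero: "v \<in> dowling G n \<Longrightarrow> v \<noteq> 0"
  by (erule dowling_leading) auto

lemma dowling_not_parallel:
  assumes "v \<in> dowling G n" "w \<in> dowling G n" "v = cscale c w"
  shows "v = w"
proof -
  obtain i where i: "v i = 1" "\<And>t. t < i \<Longrightarrow> v t = 0" using dowling_leading[OF assms(1)] by blast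
  obtain j where j: "w j = 1" "\<And>t. t < j \<Longrightarrow> w t = 0" using dowling_leading[OF assms(2)] by blast
  have eq: "v t = c * w t" for t using assms(3) by (simp add: cscale_apply)
  have "c \<noteq> 0" using i(1) eq[of i] by auto
  then have "\<not> i < j" "\<not> j < i" using i j eq[of i] eq[of j] by auto
  then have "c = 1" using i(1) j(1) eq[of i] by (simp add: linorder_neq_iff)
  then show ?thesis using assms(3) by (simp add: cscale_def)
qed

lemma dowling_frame_vec:
  assumes "G \<subseteq> roots k" "v \<in> dowling G n"
  shows "frame_vec k v"
  using assms(2)
proof (cases rule: dowling_cases)
  case (unit i)
  then have "v = cscale 1 (unit_vec i) - cscale 0 (unit_vec i)" by simp
  then show ?thesis unfolding frame_vec_def using one_mem_roots by blast
next
  case (edge i j g)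
  then have "v = cscale 1 (unit_vec i) - cscale g (unit_vec j)" by simp
  then show ?thesis unfolding frame_vec_def using one_mem_roots edge assms(1) by blast
qed

section \<open>Dowling matroids on an arbitrary label set\<close>

lemma independent_unit_vecs: "\<not> cvec.dependent (unit_vec ` A)"
proof
  assume "cvec.dependent (unit_vec ` A)"
  then obtain i where i: "unit_vec i \<in> cvec.span (unit_vec ` A - {unit_vec i})"
    by (auto simp: cvec.dependent_def)
  have "cvec.subspace {v. v i = 0}"
    by (rule cvec.subspaceI) (auto simp: cscale_apply)
  moreover have "unit_vec ` A - {unit_vec i} \<subseteq> {v. v i = 0}"
    by (auto simp: unit_vec_apply)
  ultimately have "unit_vec i \<in> {v. v i = 0}"
    using cvec.span_minimal i by blast
  then show False by (simp add: unit_vec_apply)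
qed

lemma restriction_ground_vec_matroid:
  "restriction (vec_matroid \<nu> E) (ground (vec_matroid \<nu> E)) = vec_matroid \<nu> E"
  by (auto simp: restriction_def vec_matroid_def)

text \<open>The labels of the unit vectors form a frame inside the matroid itself, so it is the
  restriction of a framed matroid to its whole ground set.\<close>

lemma dowling_matroid:
  assumes G: "finite G" and bij: "bij_betw \<nu> E (dowling G n)"
  shows "simple_matroid (vec_matroid \<nu> E)" "frame_matroid (vec_matroid \<nu> E)"
    "matroid_rank (vec_matroid \<nu> E) = n"
proof -
  have inj: "inj_on \<nu> E" and im: "\<nu> ` E = dowling G n"
    using bij by (auto simp: bij_betw_def)
  have E: "finite E"
    using bij_betw_finite[OF bij] finite_dowling[OF G] by blast
  let ?M = "vec_matroid \<nu> E"
  interpret matroid ?M by (rule matroid_vec_matroid[OF E inj])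
  have gr: "ground ?M = E" by (simp add: vec_matroid_def)
  note cl_iff = in_closure_vec_matroid_iff[OF E inj]
  have dow: "\<nu> e \<in> dowling G n" if "e \<in> E" for e using im that by blast
  have single: "{e} \<in> indeps ?M" if "e \<in> E" for e
    using that cvec.independent_insertI[of "\<nu> e" "{}"] dowling_nonzero[OF dow[OF that]]
      cvec.independent_empty by (simp add: vec_matroid_def)
  have pair: "{e, f} \<in> indeps ?M" if "e \<in> E" "f \<in> E" "e \<noteq> f" for e f
  proof -
    have "\<nu> e \<notin> cvec.span {\<nu> f}"
    proof
      assume "\<nu> e \<in> cvec.span {\<nu> f}"
      then obtain c where "\<nu> e = cscale c (\<nu> f)" by (auto simp: cvec.span_singleton)
      then have "\<nu> e = \<nu> f" using dowling_not_parallel dow that by blast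
      then show False using inj that by (auto dest: inj_onD)
    qed
    then show ?thesis
      using insert_indep_vec_matroid[OF single[OF that(2)] that(1)] by simp
  qed
  show "simple_matroid ?M"
    unfolding simple_matroid_def loop_def parallel_pair_def
    using matroid_axioms single pair by (auto simp: gr)
  define B where "B = {e \<in> E. \<nu> e \<in> unit_vec ` {..<n}}"
  have BE: "B \<subseteq> E" by (auto simp: B_def)
  have imB: "\<nu> ` B = unit_vec ` {..<n}"
  proof
    show "unit_vec ` {..<n} \<subseteq> \<nu> ` B"
    proof
      fix w assume w: "w \<in> unit_vec ` {..<n}"
      then have "w \<in> \<nu> ` E" unfolding im dowling_def by (rule UnI1)
      then obtain e where "w = \<nu> e" "e \<in> E" by (rule imageE)
      then show "w \<in> \<nu> ` B" using w by (intro image_eqI[of _ _ e]) (simp_all add: B_def)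
    qed
  qed (auto simp: B_def)
  have "card B = card (\<nu> ` B)"
    by (rule card_image[OF inj_on_subset[OF inj BE], symmetric])
  then have cardB: "card B = n"
    using imB card_image[OF inj_on_subset[OF inj_unit_vec subset_UNIV]] by simp
  have indB: "B \<in> indeps ?M"
    using BE independent_unit_vecs by (simp add: vec_matroid_def imB)
  have frame: "\<exists>S \<subseteq> B. card S \<le> 2 \<and> e \<in> cl S" if e: "e \<in> E" for e
    using dow[OF e]
  proof (cases rule: dowling_cases)
    case (unit i)
    then have "e \<in> B" using e by (auto simp: B_def)
    then show ?thesis
      using e cl_superset[of "{e}"] gr by (intro exI[of _ "{e}"]) auto
  next
    case (edge i j g)
    then have "unit_vec i \<in> \<nu> ` B" "unit_vec j \<in> \<nu> ` B" unfolding imB by auto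
    then obtain a b where ab: "a \<in> B" "b \<in> B" "unit_vec i = \<nu> a" "unit_vec j = \<nu> b"
      by blast
    have "\<nu> e \<in> cvec.span (\<nu> ` {a, b})"
      unfolding edge(4) ab
      by (rule cvec.span_diff[OF cvec.span_base cvec.span_scale[OF cvec.span_base]]) simp_all
    then have "e \<in> cl {a, b}"
      using cl_iff[of "{a, b}" e] ab(1,2) BE e by auto
    moreover have "card {a, b} \<le> 2" by (simp add: card_insert_if)
    ultimately show ?thesis using ab by (intro exI[of _ "{a, b}"]) auto
  qed
  have "E \<subseteq> cl B"
  proof
    fix e assume "e \<in> E"
    then obtain S where "S \<subseteq> B" "e \<in> cl S" using frame by blast
    then show "e \<in> cl B" using subsetD[OF cl_mono] by blast
  qed
  then have "matroid_rank ?M \<le> n"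
    unfolding matroid_rank_def gr
    using rank_le_of_subset_cl[of E B] rank_indep[OF indB] cardB by simp
  moreover have "n \<le> matroid_rank ?M"
    unfolding matroid_rank_def gr using card_le_rank[OF indB BE] cardB by simp
  ultimately show rank: "matroid_rank ?M = n" by simp
  have "framed_by ?M B"
    unfolding framed_by_def
    using matroid_axioms basis_if_card[OF indB] cardB rank frame by (simp add: gr)
  then have "framed_by ?M B \<and> ground ?M \<subseteq> ground ?M \<and> ?M = restriction ?M (ground ?M)"
    by (simp add: restriction_ground_vec_matroid)
  then show "frame_matroid ?M"
    unfolding frame_matroid_def by (intro exI)
qed

text \<open>In a triangle minor one point would lie in the span of other ground elements, whereas
  all of them are independent.\<close>

lemma dowling_empty_no_triangle_minor:
  assumes bij: "bij_betw \<nu> E (dowling {} n)"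
  shows "\<not> has_minor (vec_matroid \<nu> E) (uniform_matroid 2 3)"
proof
  have inj: "inj_on \<nu> E" and im: "\<nu> ` E = unit_vec ` {..<n}"
    using bij by (auto simp: bij_betw_def dowling_def)
  have E: "finite E"
    using bij_betw_finite[OF bij] finite_dowling by blast
  interpret matroid "vec_matroid \<nu> E" by (rule matroid_vec_matroid[OF E inj])
  assume "has_minor (vec_matroid \<nu> E) (uniform_matroid 2 3)"
  then obtain C Z where CZ: "C \<subseteq> ground (vec_matroid \<nu> E)" "Z \<subseteq> ground (vec_matroid \<nu> E)"
    "C \<inter> Z = {}" and card: "card Z = 3"
    and line: "\<And>x y z. x \<in> Z \<Longrightarrow> y \<in> Z \<Longrightarrow> z \<in> Z \<Longrightarrow> x \<noteq> y \<Longrightarrow> z \<in> cl (insert x (insert y C))"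
    by (rule has_line_minorD) blast
  obtain x y z where Z: "Z = {x, y, z}" "x \<noteq> y" "x \<noteq> z" "y \<noteq> z"
    using card by (auto simp: card_3_iff)
  have sub: "insert x (insert y C) \<subseteq> E - {z}" "z \<in> E"
    using CZ Z by (auto simp: vec_matroid_def)
  then have "\<nu> z \<in> cvec.span (\<nu> ` insert x (insert y C))"
    using line[of x y z] Z in_closure_vec_matroid_iff[OF E inj, of "insert x (insert y C)" z] by auto
  moreover have "\<nu> ` insert x (insert y C) \<subseteq> \<nu> ` E - {\<nu> z}"
    using sub inj by (auto dest: inj_onD)
  ultimately have "\<nu> z \<in> cvec.span (\<nu> ` E - {\<nu> z})"
    using cvec.span_mono by blast
  then have "cvec.dependent (\<nu> ` E)"
    using sub(2) unfolding cvec.dependent_def by blast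
  then show False
    using independent_unit_vecs im by metis
qed

text \<open>An infinite type supplies enough labels. For \<open>l = 1\<close> the group is replaced
  by the empty set, since \<open>roots 0\<close> is infinite.\<close>

lemma exists_extremal_frame_matroid:
  assumes "l \<ge> 1"
  shows "\<exists>M :: ('a :: infinite) set_system. frame_matroid M \<and>
    \<not> has_minor M (uniform_matroid 2 (l + 2)) \<and> simple_matroid M \<and> matroid_rank M = n \<and>
    card (ground M) = (l - 1) * (n choose 2) + n"
proof -
  define G where "G = (if l = 1 then {} else roots (l - 1))"
  have G: "finite G" "0 \<notin> G" "card G = l - 1"
    using assms card_roots[of "l - 1"] finite_roots[of "l - 1"] zero_notin_roots[of "l - 1"]
    by (auto simp: G_def)
  obtain E :: "'a set" where E: "finite E" "card E = card (dowling G n)"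
    using infinite_arbitrarily_large[OF infinite_UNIV] by blast
  then obtain \<nu> where \<nu>: "bij_betw \<nu> E (dowling G n)"
    using finite_same_card_bij finite_dowling[OF G(1)] by blast
  have inj: "inj_on \<nu> E" and im: "\<nu> ` E = dowling G n"
    using \<nu> by (auto simp: bij_betw_def)
  have "\<not> has_minor (vec_matroid \<nu> E) (uniform_matroid 2 (l + 2))"
  proof (cases "l = 1")
    case True
    then show ?thesis
      using dowling_empty_no_triangle_minor[of \<nu> E n] \<nu> by (simp add: G_def numeral_3_eq_3)
  next
    case False
    have "frame_vec (l - 1) (\<nu> e)" if "e \<in> E" for e
      using dowling_frame_vec[of G "l - 1" "\<nu> e" n] that im False by (auto simp: G_def)
    moreover have "l - 1 + 3 = l + 2" using assms by simp
    ultimately show ?thesis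
      using no_long_line_minor_vec_matroid[of "l - 1" E \<nu>] False assms E(1) inj by auto
  qed
  moreover have "card (ground (vec_matroid \<nu> E)) = (l - 1) * (n choose 2) + n"
    using E(2) card_dowling[OF G(1,2), of n] G(3) by (simp add: vec_matroid_def)
  ultimately show ?thesis
    using dowling_matroid[OF G(1) \<nu>] by blast
qed

section \<open>The extremal function\<close>

theorem theorem1p6:
  fixes l :: nat and \<M> :: "('a :: infinite) set_system set"
  assumes "l \<ge> 1"
    and "\<M> = {M. frame_matroid M \<and> \<not> has_minor M (uniform_matroid 2 (l + 2))}"
  shows "\<forall>n\<ge>1. finite (simple_sizes \<M> n) \<and> simple_sizes \<M> n \<noteq> {} \<and>
    extremal_function \<M> n = (l - 1) * (n choose 2) + n"
proof (intro allI impI)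
  fix n :: nat
  define h where "h = (l - 1) * (n choose 2) + n"
  have upper: "x \<le> h" if "x \<in> simple_sizes \<M> n" for x
  proof -
    from that obtain M where M: "x = card (ground M)" "M \<in> \<M>" "simple_matroid M" "matroid_rank M \<le> n"
      by (auto simp: simple_sizes_def)
    then have "x \<le> (l - 1) * (matroid_rank M choose 2) + matroid_rank M"
      using card_ground_frame_matroid_le[of l M] assms by auto
    \<comment> \<open>The bound increases with the rank, so ranks below \<open>n\<close> do no
      better; doubling removes the division from the binomial.\<close>
    also have "\<dots> \<le> h"
    proof -
      have "2 * (matroid_rank M choose 2) \<le> 2 * (n choose 2)"
        unfolding double_choose_two using M(4) by (intro mult_le_mono diff_le_mono)
      then show ?thesis
        unfolding h_def using M(4) by (intro add_le_mono mult_le_mono2) simp_all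
    qed
    finally show ?thesis .
  qed
  obtain M :: "'a set_system" where "frame_matroid M" "\<not> has_minor M (uniform_matroid 2 (l + 2))"
    "simple_matroid M" "matroid_rank M = n" "card (ground M) = h"
    using exists_extremal_frame_matroid[OF assms(1), of n] unfolding h_def by blast
  then have mem: "h \<in> simple_sizes \<M> n"
    unfolding simple_sizes_def assms(2) by (intro CollectI exI[of _ M]) simp
  have fin: "finite (simple_sizes \<M> n)"
    by (rule finite_subset[of _ "{..h}"]) (use upper in auto)
  have "extremal_function \<M> n = h"
    unfolding extremal_function_def by (rule Max_eqI[OF fin upper mem])
  then show "finite (simple_sizes \<M> n) \<and> simple_sizes \<M> n \<noteq> {} \<and>
      extremal_function \<M> n = (l - 1) * (n choose 2) + n"
    using fin mem unfolding h_def by blast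
qed

end
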